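(* Let $N\ge 1$, let $V$ be a set of $N$ vertices, and let $(\beta_k)_{k\ge1}$ be non-negative reals with $\sum_{k\ge1} k\beta_k<\infty$. Let $\Lambda$ be the Poisson random hypergraph on $V$ with parameters $(\beta_k)$, let $\beta(t)=\sum_{k\ge1}\beta_k t^k$ and $t^*=\inf\{t\ge 0:\beta'(t)+\log(1-t)<0\}$, and assume that $\beta'(t)+\log(1-t)$ has no zeros in $[0,t^* )$. Let $\mathcal{E}(N,k)$ be the number of essential $k$-edges of $\Lambda$ and $\mathcal{E}(N)=\sum_{k=1}^N\mathcal{E}(N,k)$. Then, as $N\to\infty$, the following convergences hold in probability: $$\frac{\mathcal{E}(N,k)}{N}\to k(1-t^* )(t^* )^{k-1}\beta_k \quad\text{for every } k\ge 1,\qquad \frac{\mathcal{E}(N)}{N}\to -(1-t^* )\log(1-t^* ).$$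
   Context: A Poisson random hypergraph on $V$ with parameters $(\beta_k)_{k\ge1}$ is a random map $\Lambda:\mathcal{P}(V)\to\mathbb{Z}^+$ such that the $\Lambda(A)$, $A\subseteq V$, are independent and $\Lambda(A)\sim\mathrm{Poisson}(N\beta_k/\binom{N}{k})$ when $|A|=k$; $\Lambda(A)$ is the number of hyperedges over $A$ (multiple hyperedges allowed), and a hyperedge over a set of size $k$ is a $k$-edge; 1-edges are called patches. Identifiable vertices: repeatedly pick a vertex carrying a patch, delete that vertex and the patch, and collapse every other hyperedge containing it onto its remaining vertices (e.g. a 3-edge over $\{u,v,w\}$ becomes a 2-edge over $\{u,w\}$); continue until no patches remain. The set of vertices removed does not depend on the order of choices; it is the set $V^*(\Lambda)$ of identifiable vertices. A hyperedge is essential if removing it (before the collapse) reduces the number of identifiable vertices. *)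

theory Defs
  imports "HOL-Analysis.Analysis" "HOL-Probability.Probability" "HOL-Library.Multiset"
begin

definition pois :: "real \<Rightarrow> nat pmf" where
  "pois r = (if 0 < r then poisson_pmf r else return_pmf 0)"

(* Vertex set V = {..<N}.  A hypergraph is a map Lambda : P(V) -> nat (multiplicities). *)
definition poisson_hypergraph :: "(nat \<Rightarrow> real) \<Rightarrow> nat \<Rightarrow> (nat set \<Rightarrow> nat) pmf" where
  "poisson_hypergraph beta N =
     Pi_pmf {A. A \<subseteq> {..<N} \<and> A \<noteq> {}} 0
       (\<lambda>A. pois (real N * beta (card A) / real (N choose card A)))"

definition edges_mset :: "nat \<Rightarrow> (nat set \<Rightarrow> nat) \<Rightarrow> nat set multiset" where
  "edges_mset N Lam = (\<Sum>A\<in>Pow {..<N}. replicate_mset (Lam A) A)"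

inductive ident_step :: "nat set multiset \<times> nat set \<Rightarrow> nat set multiset \<times> nat set \<Rightarrow> bool" where
  "{v} \<in># H \<Longrightarrow>
   ident_step (H, S) (image_mset (\<lambda>B. B - {v}) (H - {#{v}#}), insert v S)"

definition ident_terminal :: "nat set multiset \<times> nat set \<Rightarrow> bool" where
  "ident_terminal st \<longleftrightarrow> (\<forall>v. {v} \<notin># fst st)"

(* The set of identifiable vertices: the set of vertices removed by the process run until
   no patch remains (independent of the choices made). *)
definition identifiable :: "nat \<Rightarrow> (nat set \<Rightarrow> nat) \<Rightarrow> nat set" where
  "identifiable N Lam =
     (SOME S. \<exists>H. ident_step\<^sup>*\<^sup>* (edges_mset N Lam, {}) (H, S) \<and> ident_terminal (H, S))"

definition essential_count :: "nat \<Rightarrow> nat \<Rightarrow> (nat set \<Rightarrow> nat) \<Rightarrow> nat" where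
  "essential_count N k Lam =
     (\<Sum>A\<in>{A. A \<subseteq> {..<N} \<and> card A = k}.
        if card (identifiable N (Lam(A := Lam A - 1))) < card (identifiable N Lam)
        then Lam A else 0)"

definition essential_total :: "nat \<Rightarrow> (nat set \<Rightarrow> nat) \<Rightarrow> nat" where
  "essential_total N Lam = (\<Sum>k=1..N. essential_count N k Lam)"

definition beta_fun :: "(nat \<Rightarrow> real) \<Rightarrow> real \<Rightarrow> real" where
  "beta_fun beta t = (\<Sum>k. beta (Suc k) * t ^ Suc k)"

(* t* = inf {t >= 0 : beta'(t) + log(1-t) < 0}; the set is restricted to t < 1 where
   log(1-t) is defined (it is nonempty there, so the infimum is unchanged). *)
definition tstar :: "(nat \<Rightarrow> real) \<Rightarrow> real" where
  "tstar beta = Inf {t. 0 \<le> t \<and> t < 1 \<and> deriv (beta_fun beta) t + ln (1 - t) < 0}"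

definition conv_in_prob :: "(nat \<Rightarrow> 'a pmf) \<Rightarrow> (nat \<Rightarrow> 'a \<Rightarrow> real) \<Rightarrow> real \<Rightarrow> bool" where
  "conv_in_prob P X c \<longleftrightarrow>
     (\<forall>e>0. (\<lambda>N. measure_pmf.prob (P N) {x. \<bar>X N x - c\<bar> > e}) \<longlonglongrightarrow> 0)"

end

theory Submission
  imports Defs
begin

text \<open>
  The identifiable vertices form the least set \<open>S\<close> such that no hyperedge \<open>A\<close> satisfies
  \<open>card (A - S) = 1\<close>. For independent Poisson edges the probability that this set equals \<open>S\<close>
  factors into the probability that the edges inside \<open>S\<close> identify all of \<open>S\<close>, and
  \<open>exp (- (N - n) h n)\<close> with \<open>n = card S\<close>, where \<open>h n\<close> is the total rate of the edges that
  would add a given vertex. Summing to one on every vertex subset, this recursion shows that \<open>h\<close>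
  determines the law. A system of \<open>N\<close> independent thresholds, in which a vertex is added at size
  \<open>n\<close> with probability \<open>1 - exp (- h n)\<close>, has the same \<open>h\<close>; there the size of the final set
  is governed by empirical counts, and Chebyshev's inequality together with
  \<open>h (t N) \<longlonglongrightarrow> \<beta>' t\<close> gives convergence of the density of identifiable vertices to \<open>t*\<close>.

  An edge is essential iff it is simple and, after its removal, exactly one of its vertices is not
  identifiable. Since adding a point to a Poisson variable reweights it by its rate, the mean number
  of essential \<open>k\<close>-edges is the rate times the mean number of \<open>k\<close>-sets with exactly one
  non-identifiable vertex. In the second moment, two added edges interact only if one of them newly
  identifies a vertex of the other; summed over all edges, this is the correlation of the closure
  with a centred sum of independent variables of standard deviation \<open>O (sqrt N)\<close>, which is
  negligible.
\<close>

section \<open>Independent Poisson variables\<close>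

definition pois_prod :: "'i set \<Rightarrow> ('i \<Rightarrow> real) \<Rightarrow> ('i \<Rightarrow> nat) pmf" where
  "pois_prod I r = Pi_pmf I 0 (\<lambda>i. pois (r i))"

lemma pmf_pois_0: "r \<ge> 0 \<Longrightarrow> pmf (pois r) 0 = exp (- r)"
  by (simp add: pois_def)

lemma pmf_pois_1: "r \<ge> 0 \<Longrightarrow> pmf (pois r) 1 = r * exp (- r)"
  by (simp add: pois_def)

lemma prob_pair_pmf_Times:
  "measure_pmf.prob (pair_pmf p q) (A \<times> B) = measure_pmf.prob p A * measure_pmf.prob q B"
proof -
  \<comment> \<open>Intersecting with the supports makes both factors countable, so that
    \<open>measure_pmf_prob_product\<close> applies.\<close>
  have "measure_pmf.prob (pair_pmf p q) (A \<times> B) =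
      measure_pmf.prob (pair_pmf p q) ((A \<inter> set_pmf p) \<times> (B \<inter> set_pmf q))"
    by (subst measure_Int_set_pmf[symmetric]) (auto intro!: arg_cong[where f = "measure_pmf.prob _"])
  also have "\<dots> = measure_pmf.prob p (A \<inter> set_pmf p) * measure_pmf.prob q (B \<inter> set_pmf q)"
    by (intro measure_pmf_prob_product) auto
  finally show ?thesis
    by (simp add: measure_Int_set_pmf)
qed

text \<open>The product splits along \<open>J\<close> and \<open>I - J\<close> into a pair of
  independent factors. The two congruence hypotheses say that \<open>P\<close> reads only the first
  factor and \<open>Q\<close> only the second.\<close>

lemma prob_Pi_pmf_indep:
  assumes "finite I" "J \<subseteq> I"
    and P: "\<And>x y. (\<forall>i\<in>J. x i = y i) \<Longrightarrow> P x \<longleftrightarrow> P y"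
    and Q: "\<And>x y. (\<forall>i\<in>I - J. x i = y i) \<Longrightarrow> Q x \<longleftrightarrow> Q y"
  shows "measure_pmf.prob (Pi_pmf I d p) {x. P x \<and> Q x} =
    measure_pmf.prob (Pi_pmf I d p) {x. P x} * measure_pmf.prob (Pi_pmf I d p) {x. Q x}"
proof -
  let ?h = "\<lambda>(f, g) x. if x \<in> J then f x else g x"
  have eq: "Pi_pmf I d p = map_pmf ?h (pair_pmf (Pi_pmf J d p) (Pi_pmf (I - J) d p))"
    using Pi_pmf_union[of J "I - J" d p] assms(1,2) by (auto simp: finite_subset Un_absorb1)
  have P': "P (\<lambda>x. if x \<in> J then f x else g x) \<longleftrightarrow> P f" for f g
    by (rule P) auto
  have Q': "Q (\<lambda>x. if x \<in> J then f x else g x) \<longleftrightarrow> Q g" for f g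
    by (rule Q) auto
  have 1: "measure_pmf.prob (Pi_pmf I d p) {x. P x \<and> Q x} =
     measure_pmf.prob (pair_pmf (Pi_pmf J d p) (Pi_pmf (I - J) d p)) ({x. P x} \<times> {x. Q x})"
    unfolding eq measure_map_pmf by (intro arg_cong[where f = "measure_pmf.prob _"]) (auto simp: P' Q')
  have 2: "measure_pmf.prob (Pi_pmf I d p) {x. P x} =
     measure_pmf.prob (pair_pmf (Pi_pmf J d p) (Pi_pmf (I - J) d p)) ({x. P x} \<times> UNIV)"
    unfolding eq measure_map_pmf by (intro arg_cong[where f = "measure_pmf.prob _"]) (auto simp: P')
  have 3: "measure_pmf.prob (Pi_pmf I d p) {x. Q x} =
     measure_pmf.prob (pair_pmf (Pi_pmf J d p) (Pi_pmf (I - J) d p)) (UNIV \<times> {x. Q x})"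
    unfolding eq measure_map_pmf by (intro arg_cong[where f = "measure_pmf.prob _"]) (auto simp: Q')
  show ?thesis
    unfolding 1 2 3 prob_pair_pmf_Times by simp
qed

lemma prob_pois_prod_vacant:
  assumes "finite I" "J \<subseteq> I" "\<And>i. i \<in> I \<Longrightarrow> r i \<ge> 0"
  shows "measure_pmf.prob (pois_prod I r) {L. \<forall>i\<in>J. L i = 0} = exp (- (\<Sum>i\<in>J. r i))"
proof -
  let ?B = "\<lambda>i. if i \<in> J then {0::nat} else UNIV"
  have fJ: "finite J"
    using assms finite_subset by blast
  have "{L. \<forall>i\<in>J. L i = 0} = Pi I ?B"
    using assms(2) by (auto simp: Pi_def)
  then have "measure_pmf.prob (pois_prod I r) {L. \<forall>i\<in>J. L i = 0} =
      (\<Prod>i\<in>I. measure_pmf.prob (pois (r i)) (?B i))"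
    unfolding pois_prod_def by (simp add: measure_Pi_pmf_Pi[OF assms(1)])
  also have "\<dots> = (\<Prod>i\<in>J. measure_pmf.prob (pois (r i)) (?B i))"
    using assms(1,2) by (intro prod.mono_neutral_right) auto
  also have "\<dots> = (\<Prod>i\<in>J. exp (- r i))"
    using assms by (intro prod.cong) (auto simp: measure_pmf_single pmf_pois_0)
  finally show ?thesis
    using fJ by (simp add: exp_sum sum_negf[symmetric])
qed

lemma prob_Pi_pmf_component:
  assumes "finite I" "i \<in> I"
  shows "measure_pmf.prob (Pi_pmf I d p) {x. x i = y} = pmf (p i) y"
proof -
  have "measure_pmf.prob (Pi_pmf I d p) {x. x i = y} =
      measure_pmf.prob (map_pmf (\<lambda>f. f i) (Pi_pmf I d p)) {y}"
    unfolding measure_map_pmf by (intro arg_cong[where f = "measure_pmf.prob _"]) auto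
  then show ?thesis
    using assms by (simp add: Pi_pmf_component measure_pmf_single)
qed

text \<open>The Poisson weights satisfy \<open>pmf (pois r) 1 = r * pmf (pois r) 0\<close>, and the
  remaining coordinates are independent of coordinate \<open>i\<close>. This is the one-point form
  of the Mecke formula.\<close>

lemma pois_prod_add_point:
  assumes "finite I" "i \<in> I" "r i \<ge> 0"
  shows "measure_pmf.prob (pois_prod I r) {L. L i = 1 \<and> Q (L(i := 0))} =
    r i * measure_pmf.prob (pois_prod I r) {L. L i = 0 \<and> Q L}"
proof -
  \<comment> \<open>\<open>Q\<close> may inspect arguments outside \<open>I\<close>. Setting these
    to 0 changes nothing on the support and gives a predicate that depends only on
    \<open>I - {i}\<close>.\<close>
  define Q' where "Q' L = Q (\<lambda>j. if j \<in> I \<and> j \<noteq> i then L j else 0)" for L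
  have Q': "Q (L(i := 0)) \<longleftrightarrow> Q' L" if "L \<in> set_pmf (pois_prod I r)" for L
  proof -
    have "L(i := 0) = (\<lambda>j. if j \<in> I \<and> j \<noteq> i then L j else 0)"
      using subsetD[OF set_Pi_pmf_subset[OF assms(1)] that[unfolded pois_prod_def]]
      by (auto simp: fun_eq_iff)
    then show ?thesis
      by (simp add: Q'_def)
  qed
  have indep: "measure_pmf.prob (pois_prod I r) {L. L i = n \<and> Q' L} =
      pmf (pois (r i)) n * measure_pmf.prob (pois_prod I r) {L. Q' L}" for n
  proof -
    have "measure_pmf.prob (pois_prod I r) {L. L i = n \<and> Q' L} =
        measure_pmf.prob (pois_prod I r) {L. L i = n} * measure_pmf.prob (pois_prod I r) {L. Q' L}"
      unfolding pois_prod_def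
    proof (rule prob_Pi_pmf_indep[where J = "{i}"])
      fix x y :: "'a \<Rightarrow> nat" assume "\<forall>j\<in>I - {i}. x j = y j"
      then have "(\<lambda>j. if j \<in> I \<and> j \<noteq> i then x j else 0) = (\<lambda>j. if j \<in> I \<and> j \<noteq> i then y j else 0)"
        by auto
      then show "Q' x \<longleftrightarrow> Q' y"
        by (simp add: Q'_def)
    qed (use assms in auto)
    then show ?thesis
      using assms by (simp add: pois_prod_def prob_Pi_pmf_component)
  qed
  have "measure_pmf.prob (pois_prod I r) {L. L i = 1 \<and> Q (L(i := 0))} =
      measure_pmf.prob (pois_prod I r) {L. L i = 1 \<and> Q' L}"
    by (rule measure_pmf.finite_measure_eq_AE) (auto simp: AE_measure_pmf_iff Q')
  moreover have "measure_pmf.prob (pois_prod I r) {L. L i = 0 \<and> Q L} =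
      measure_pmf.prob (pois_prod I r) {L. L i = 0 \<and> Q' L}"
  proof (rule measure_pmf.finite_measure_eq_AE)
    show "AE L in measure_pmf (pois_prod I r).
        (L \<in> {L. L i = 0 \<and> Q L}) = (L \<in> {L. L i = 0 \<and> Q' L})"
      unfolding AE_measure_pmf_iff
    proof
      fix L assume L: "L \<in> set_pmf (pois_prod I r)"
      have "L(i := 0) = L" if "L i = 0"
        using that by auto
      then show "(L \<in> {L. L i = 0 \<and> Q L}) = (L \<in> {L. L i = 0 \<and> Q' L})"
        using Q'[OF L] by auto
    qed
  qed auto
  ultimately show ?thesis
    using assms by (simp add: indep pmf_pois_0 pmf_pois_1 del: One_nat_def)
qed

section \<open>Random closures\<close>

text \<open>\<open>R i S v\<close> is read as: once \<open>S\<close> is present, item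
  \<open>i\<close> adds vertex \<open>v\<close>. The vertex set \<open>U\<close> is a parameter
  because the recursion below restricts one system to all its subsets.\<close>

definition fire_closed :: "('i \<Rightarrow> nat set \<Rightarrow> nat \<Rightarrow> bool) \<Rightarrow> 'i set \<Rightarrow> nat set \<Rightarrow> nat set \<Rightarrow> bool" where
  "fire_closed R act U S \<longleftrightarrow> S \<subseteq> U \<and> (\<forall>i\<in>act. \<forall>v\<in>U - S. \<not> R i S v)"

definition fire_closure :: "('i \<Rightarrow> nat set \<Rightarrow> nat \<Rightarrow> bool) \<Rightarrow> 'i set \<Rightarrow> nat set \<Rightarrow> nat set" where
  "fire_closure R act U = \<Inter> {S. fire_closed R act U S}"

definition active :: "'i set \<Rightarrow> ('i \<Rightarrow> nat) \<Rightarrow> 'i set" where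
  "active I L = {i \<in> I. L i > 0}"

text \<open>An item that can add \<open>v\<close> keeps this ability while the present set grows,
  until \<open>v\<close> itself is present. The condition \<open>v \<notin> T\<close> reflects that
  an edge is exhausted once its last vertex has been added.\<close>

locale firing_rule =
  fixes R :: "'i \<Rightarrow> nat set \<Rightarrow> nat \<Rightarrow> bool" and V :: "nat set"
  assumes finite_V: "finite V"
    and R_mono: "\<And>i S T v. R i S v \<Longrightarrow> S \<subseteq> T \<Longrightarrow> T \<subseteq> V \<Longrightarrow> v \<notin> T \<Longrightarrow> R i T v"
begin

lemma fire_closed_top: "fire_closed R act U U"
  by (auto simp: fire_closed_def)

text \<open>A vertex outside the intersection is missed by some closed \<open>S\<close>. Firing into
  it from the intersection would, by monotonicity, also happen from \<open>S\<close>.\<close>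

lemma fire_closed_fire_closure:
  assumes "U \<subseteq> V"
  shows "fire_closed R act U (fire_closure R act U)"
  unfolding fire_closed_def
proof (intro conjI ballI notI)
  show "fire_closure R act U \<subseteq> U"
    unfolding fire_closure_def using fire_closed_top by blast
next
  fix i v assume i: "i \<in> act" and v: "v \<in> U - fire_closure R act U"
    and R: "R i (fire_closure R act U) v"
  then obtain S where S: "fire_closed R act U S" "v \<notin> S"
    by (auto simp: fire_closure_def)
  then have "R i S v"
    using R_mono[OF R] assms by (auto simp: fire_closure_def fire_closed_def)
  then show False
    using S i v by (auto simp: fire_closed_def)
qed

lemma fire_closure_least: "fire_closed R act U S \<Longrightarrow> fire_closure R act U \<subseteq> S"
  by (auto simp: fire_closure_def)

lemma fire_closure_subset: "fire_closure R act U \<subseteq> U"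
  using fire_closed_top fire_closure_least by blast

lemma fire_closure_eqI:
  assumes "U \<subseteq> V" "fire_closed R act U S" "\<And>T. fire_closed R act U T \<Longrightarrow> T \<subseteq> S \<Longrightarrow> S \<subseteq> T"
  shows "fire_closure R act U = S"
  using assms fire_closed_fire_closure fire_closure_least by (meson subset_antisym)

text \<open>Restricting the vertex set to \<open>S\<close> separates what happens inside \<open>S\<close> from
  the event that nothing fires out of \<open>S\<close>.\<close>

lemma fire_closure_eq_iff:
  assumes "S \<subseteq> U" "U \<subseteq> V"
  shows "fire_closure R act U = S \<longleftrightarrow>
    fire_closure R act S = S \<and> (\<forall>i\<in>act. \<forall>v\<in>U - S. \<not> R i S v)"
proof
  assume eq: "fire_closure R act U = S"
  then have cl: "fire_closed R act U S"
    using fire_closed_fire_closure assms by blast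
  have "fire_closure R act S = S"
  proof (rule fire_closure_eqI)
    fix T assume T: "fire_closed R act S T"
    \<comment> \<open>A set closed inside \<open>S\<close> is closed inside \<open>U\<close>: a
      firing into \<open>U - S\<close> would also occur from the larger set \<open>S\<close>, which
      is closed.\<close>
    have "fire_closed R act U T"
      unfolding fire_closed_def
    proof (intro conjI ballI notI)
      show "T \<subseteq> U"
        using T assms by (auto simp: fire_closed_def)
      fix i v assume *: "i \<in> act" "v \<in> U - T" "R i T v"
      show False
      proof (cases "v \<in> S")
        case True
        then show ?thesis
          using * T by (auto simp: fire_closed_def)
      next
        case False
        then have "R i S v"
          using * T assms by (intro R_mono[OF *(3)]) (auto simp: fire_closed_def)
        then show ?thesis
          using * cl False by (auto simp: fire_closed_def)
      qed
    qed
    then show "S \<subseteq> T"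
      using eq fire_closure_least by blast
  qed (use assms in \<open>auto simp: fire_closed_top\<close>)
  then show "fire_closure R act S = S \<and> (\<forall>i\<in>act. \<forall>v\<in>U - S. \<not> R i S v)"
    using cl by (auto simp: fire_closed_def)
next
  assume *: "fire_closure R act S = S \<and> (\<forall>i\<in>act. \<forall>v\<in>U - S. \<not> R i S v)"
  show "fire_closure R act U = S"
  proof (rule fire_closure_eqI)
    fix T assume "fire_closed R act U T" "T \<subseteq> S"
    then have "fire_closed R act S T"
      using assms by (auto simp: fire_closed_def)
    then show "S \<subseteq> T"
      using * fire_closure_least by blast
  qed (use * assms in \<open>auto simp: fire_closed_def\<close>)
qed

end

text \<open>\<open>R_inner_outer\<close> separates the items that act inside \<open>S\<close> from
  those that fire out of \<open>S\<close>, which yields independence. \<open>rate\<close> lets the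
  total rate out of \<open>S\<close> depend on cardinalities only.\<close>

locale random_firing = firing_rule R V
  for R :: "'i \<Rightarrow> nat set \<Rightarrow> nat \<Rightarrow> bool" and V +
  fixes I :: "'i set" and r :: "'i \<Rightarrow> real" and h :: "nat \<Rightarrow> real"
  assumes finite_I: "finite I"
    and r_nonneg: "\<And>i. i \<in> I \<Longrightarrow> r i \<ge> 0"
    and R_inner_outer: "\<And>i S T v w. R i T v \<Longrightarrow> T \<subseteq> S \<Longrightarrow> v \<in> S - T \<Longrightarrow> w \<notin> S \<Longrightarrow> \<not> R i S w"
    and rate: "\<And>S U. S \<subseteq> U \<Longrightarrow> U \<subseteq> V \<Longrightarrow>
      (\<Sum>i | i \<in> I \<and> (\<exists>v\<in>U - S. R i S v). r i) = real (card U - card S) * h (card S)"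
begin

definition closure_prob :: "nat set \<Rightarrow> nat set \<Rightarrow> real" where
  "closure_prob U S = measure_pmf.prob (pois_prod I r) {L. fire_closure R (active I L) U = S}"

text \<open>The closure in \<open>U\<close> is \<open>S\<close> exactly when \<open>S\<close> fills
  up from within and every item of \<open>K\<close>, those firing from \<open>S\<close> into
  \<open>U - S\<close>, is vacant. The two events involve disjoint sets of items.\<close>

lemma closure_prob_factor:
  assumes "S \<subseteq> U" "U \<subseteq> V"
  shows "closure_prob U S = closure_prob S S * exp (- (real (card U - card S) * h (card S)))"
proof -
  define K where "K = {i \<in> I. \<exists>v\<in>U - S. R i S v}"
  have "closure_prob U S =
      measure_pmf.prob (pois_prod I r) {L. (\<forall>i\<in>K. L i = 0) \<and> fire_closure R (active I L) S = S}"
    unfolding closure_prob_def fire_closure_eq_iff[OF assms]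
    by (intro arg_cong[where f = "measure_pmf.prob _"]) (auto simp: K_def active_def)
  also have "\<dots> = measure_pmf.prob (pois_prod I r) {L. \<forall>i\<in>K. L i = 0} * closure_prob S S"
    unfolding pois_prod_def closure_prob_def
  proof (rule prob_Pi_pmf_indep[where J = K])
    fix x y :: "'i \<Rightarrow> nat" assume xy: "\<forall>i\<in>I - K. x i = y i"
    \<comment> \<open>Closedness inside \<open>S\<close> is tested only by items that fire inside
      \<open>S\<close>. By \<open>R_inner_outer\<close> these lie outside \<open>K\<close>, where
      \<open>x\<close> and \<open>y\<close> agree.\<close>
    have "fire_closed R (active I x) S T \<longleftrightarrow> fire_closed R (active I y) S T" for T
    proof -
      have "x i = y i" if "i \<in> I" "T \<subseteq> S" "v \<in> S - T" "R i T v" for i v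
        using xy that R_inner_outer[OF that(4,2,3)] by (auto simp: K_def)
      then show ?thesis
        unfolding fire_closed_def active_def by fastforce
    qed
    then show "fire_closure R (active I x) S = S \<longleftrightarrow> fire_closure R (active I y) S = S"
      by (simp add: fire_closure_def)
  qed (auto simp: K_def finite_I)
  also have "measure_pmf.prob (pois_prod I r) {L. \<forall>i\<in>K. L i = 0} = exp (- (\<Sum>i\<in>K. r i))"
    by (rule prob_pois_prod_vacant) (auto simp: K_def finite_I r_nonneg)
  also have "(\<Sum>i\<in>K. r i) = real (card U - card S) * h (card S)"
    unfolding K_def using rate[OF assms] .
  finally show ?thesis
    by simp
qed

lemma sum_closure_prob:
  assumes "U \<subseteq> V"
  shows "(\<Sum>S\<in>Pow U. closure_prob U S) = 1"
proof -
  have fin: "finite (Pow U)"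
    using assms finite_V finite_subset by blast
  have "(\<Sum>S\<in>Pow U. closure_prob U S) =
      measure_pmf.prob (pois_prod I r) (\<Union>S\<in>Pow U. {L. fire_closure R (active I L) U = S})"
    unfolding closure_prob_def
    by (rule measure_pmf.finite_measure_finite_Union[symmetric])
       (use fin in \<open>auto simp: disjoint_family_on_def\<close>)
  also have "(\<Union>S\<in>Pow U. {L. fire_closure R (active I L) U = S}) = UNIV"
    using fire_closure_subset by auto
  finally show ?thesis
    by simp
qed

text \<open>Total mass one is solved for the term \<open>S = U\<close>. The right-hand side involves
  only proper subsets, which makes this a recursion.\<close>

lemma closure_prob_full:
  assumes "U \<subseteq> V"
  shows "closure_prob U U = 1 - (\<Sum>S\<in>Pow U - {U}.
    closure_prob S S * exp (- (real (card U - card S) * h (card S))))"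
proof -
  have "finite (Pow U)"
    using assms finite_V finite_subset by blast
  then have "1 = closure_prob U U + (\<Sum>S\<in>Pow U - {U}. closure_prob U S)"
    using sum_closure_prob[OF assms] by (simp add: sum.remove[of "Pow U" U])
  also have "(\<Sum>S\<in>Pow U - {U}. closure_prob U S) =
      (\<Sum>S\<in>Pow U - {U}. closure_prob S S * exp (- (real (card U - card S) * h (card S))))"
    using assms by (intro sum.cong refl closure_prob_factor) auto
  finally show ?thesis
    by simp
qed

lemma prob_fire_closure:
  "measure_pmf.prob (pois_prod I r) {L. Q (fire_closure R (active I L) V)} =
    (\<Sum>S | S \<subseteq> V \<and> Q S. closure_prob V S)"
proof -
  have "{L. Q (fire_closure R (active I L) V)} =
      (\<Union>S\<in>{S. S \<subseteq> V \<and> Q S}. {L. fire_closure R (active I L) V = S})"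
    using fire_closure_subset by auto
  moreover have "finite {S. S \<subseteq> V \<and> Q S}"
    using finite_V by simp
  ultimately show ?thesis
    unfolding closure_prob_def
    by (simp only:) (rule measure_pmf.finite_measure_finite_Union, auto simp: disjoint_family_on_def)
qed

end

text \<open>The triangular recursion satisfied by the probabilities that all of \<open>U\<close> is
  reached only involves \<open>h\<close>, so \<open>h\<close> determines the law of the closure.\<close>

theorem random_firing_law_unique:
  assumes "random_firing R V I r h" "random_firing R' V I' r' h"
  shows "measure_pmf.prob (pois_prod I r) {L. Q (fire_closure R (active I L) V)} =
    measure_pmf.prob (pois_prod I' r') {L. Q (fire_closure R' (active I' L) V)}"
proof -
  interpret A: random_firing R V I r h by fact
  interpret B: random_firing R' V I' r' h by fact
  have full: "A.closure_prob U U = B.closure_prob U U" if "U \<subseteq> V" for U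
  proof -
    have "finite U"
      using that A.finite_V finite_subset by blast
    then show ?thesis
      using that
    proof (induction U rule: finite_psubset_induct)
      case (psubset U)
      have "A.closure_prob S S = B.closure_prob S S" if "S \<in> Pow U - {U}" for S
        using that psubset by (intro psubset.IH) auto
      then show ?case
        using psubset.prems by (simp add: A.closure_prob_full B.closure_prob_full)
    qed
  qed
  then show ?thesis
    unfolding A.prob_fire_closure B.prob_fire_closure
    by (intro sum.cong refl) (auto simp: A.closure_prob_factor[of _ V] B.closure_prob_factor[of _ V])
qed

lemma sum_Pow_card:
  assumes "finite S"
  shows "(\<Sum>B\<in>Pow S. f (card B)) = (\<Sum>j\<le>card S. real (card S choose j) * f j)"
proof -
  have "(\<Sum>B\<in>Pow S. f (card B)) = (\<Sum>j\<in>{..card S}. \<Sum>B | B \<in> Pow S \<and> card B = j. f (card B))"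
    by (rule sum.group[symmetric]) (use assms in \<open>auto intro: card_mono\<close>)
  also have "\<dots> = (\<Sum>j\<le>card S. real (card S choose j) * f j)"
  proof (rule sum.cong)
    fix j assume "j \<in> {..card S}"
    have "(\<Sum>B | B \<in> Pow S \<and> card B = j. f (card B)) = (\<Sum>B | B \<in> Pow S \<and> card B = j. f j)"
      by (rule sum.cong) auto
    also have "\<dots> = real (card {B. B \<subseteq> S \<and> card B = j}) * f j"
      by simp
    finally show "(\<Sum>B | B \<in> Pow S \<and> card B = j. f (card B)) = real (card S choose j) * f j"
      by (simp add: n_subsets[OF assms])
  qed simp
  finally show ?thesis .
qed

section \<open>Hypergraphs and thresholds as firing systems\<close>

definition edge_fires :: "nat set \<Rightarrow> nat set \<Rightarrow> nat \<Rightarrow> bool" where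
  "edge_fires A S v \<longleftrightarrow> A - S = {v}"

definition edge_sets :: "nat \<Rightarrow> nat set set" where
  "edge_sets N = {A. A \<subseteq> {..<N} \<and> A \<noteq> {}}"

definition edge_rate :: "(nat \<Rightarrow> real) \<Rightarrow> nat \<Rightarrow> nat \<Rightarrow> real" where
  "edge_rate beta N k = real N * beta k / real (N choose k)"

text \<open>An edge that adds a given vertex \<open>v\<close> to a set of \<open>n\<close> vertices
  is \<open>v\<close> together with \<open>j\<close> of these vertices. It has size
  \<open>Suc j\<close>, and there are \<open>n choose j\<close> choices.\<close>

definition fire_rate :: "(nat \<Rightarrow> real) \<Rightarrow> nat \<Rightarrow> nat \<Rightarrow> real" where
  "fire_rate beta N n = (\<Sum>j\<le>n. real (n choose j) * edge_rate beta N (Suc j))"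

definition patch_closure :: "nat \<Rightarrow> (nat set \<Rightarrow> nat) \<Rightarrow> nat set" where
  "patch_closure N L = fire_closure edge_fires (active (edge_sets N) L) {..<N}"

lemma poisson_hypergraph_eq:
  "poisson_hypergraph beta N = pois_prod (edge_sets N) (\<lambda>A. edge_rate beta N (card A))"
  by (simp add: poisson_hypergraph_def pois_prod_def edge_sets_def edge_rate_def)

lemma finite_edge_sets: "finite (edge_sets N)"
  by (simp add: edge_sets_def)

lemma edge_rate_nonneg: "(\<And>k. k \<ge> 1 \<Longrightarrow> beta k \<ge> 0) \<Longrightarrow> k \<ge> 1 \<Longrightarrow> edge_rate beta N k \<ge> 0"
  by (simp add: edge_rate_def)

lemma firing_rule_edge: "firing_rule edge_fires {..<N}"
  by unfold_locales (auto simp: edge_fires_def)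

text \<open>An edge firing from \<open>S\<close> into \<open>U - S\<close> is uniquely
  \<open>insert v B\<close> with \<open>v\<close> in \<open>U - S\<close> and \<open>B\<close>
  inside \<open>S\<close>. The weight \<open>f\<close> is kept general: it serves for rates here and
  for counting sets of a fixed size later.\<close>

lemma sum_firing_edges:
  assumes SU: "S \<subseteq> U" "U \<subseteq> {..<N}"
  shows "(\<Sum>A | A \<in> edge_sets N \<and> (\<exists>v\<in>U - S. edge_fires A S v). f (card A)) =
    real (card U - card S) * (\<Sum>j\<le>card S. real (card S choose j) * f (Suc j))"
proof -
  have fin: "finite S" "finite U"
    using SU by (auto intro: finite_subset[OF _ finite_lessThan[of N]])
  have "(\<Sum>A | A \<in> edge_sets N \<and> (\<exists>v\<in>U - S. edge_fires A S v). f (card A)) =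
      (\<Sum>(v, B)\<in>(U - S) \<times> Pow S. f (Suc (card B)))"
  proof (rule sum.reindex_bij_witness[where j = "\<lambda>A. (THE v. A - S = {v}, A \<inter> S)"
          and i = "\<lambda>(v, B). insert v B"])
    fix A assume "A \<in> {A. A \<in> edge_sets N \<and> (\<exists>v\<in>U - S. edge_fires A S v)}"
    then obtain v where v: "v \<in> U - S" "A - S = {v}" "A \<in> edge_sets N"
      by (auto simp: edge_fires_def)
    have A: "A = insert v (A \<inter> S)"
      using v by auto
    show "(case (THE v. A - S = {v}, A \<inter> S) of (v, B) \<Rightarrow> insert v B) = A"
      using v A by simp
    show "(THE v. A - S = {v}, A \<inter> S) \<in> (U - S) \<times> Pow S"
      using v by simp
    have "card A = Suc (card (A \<inter> S))"
      using v(1) fin by (subst A) auto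
    then show "(case (THE v. A - S = {v}, A \<inter> S) of (v, B) \<Rightarrow> f (Suc (card B))) = f (card A)"
      by simp
  next
    fix p assume "p \<in> (U - S) \<times> Pow S"
    then obtain v B where p: "p = (v, B)" "v \<in> U - S" "B \<subseteq> S"
      by auto
    have *: "insert v B - S = {v}" "insert v B \<inter> S = B"
      using p by auto
    show "(THE w. (case p of (v, B) \<Rightarrow> insert v B) - S = {w}, (case p of (v, B) \<Rightarrow> insert v B) \<inter> S) = p"
      using p * by simp
    show "(case p of (v, B) \<Rightarrow> insert v B) \<in> {A. A \<in> edge_sets N \<and> (\<exists>v\<in>U - S. edge_fires A S v)}"
      using p * SU by (auto simp: edge_sets_def edge_fires_def)
  qed
  also have "\<dots> = real (card (U - S)) * (\<Sum>B\<in>Pow S. f (Suc (card B)))"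
    by (simp add: sum.cartesian_product[symmetric])
  also have "(\<Sum>B\<in>Pow S. f (Suc (card B))) = (\<Sum>j\<le>card S. real (card S choose j) * f (Suc j))"
    by (rule sum_Pow_card[OF fin(1), of "\<lambda>n. f (Suc n)"])
  finally show ?thesis
    using SU fin by (simp add: card_Diff_subset)
qed

lemma random_firing_edge:
  assumes nonneg: "\<And>k. k \<ge> 1 \<Longrightarrow> beta k \<ge> 0"
  shows "random_firing edge_fires {..<N} (edge_sets N) (\<lambda>A. edge_rate beta N (card A)) (fire_rate beta N)"
proof -
  interpret firing_rule edge_fires "{..<N}"
    by (rule firing_rule_edge)
  show ?thesis
  proof
    show "edge_rate beta N (card A) \<ge> 0" if "A \<in> edge_sets N" for A
      using that finite_subset[of A "{..<N}"] card_gt_0_iff[of A]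
      by (intro edge_rate_nonneg nonneg) (auto simp: edge_sets_def)
  next
    fix S U :: "nat set" assume "S \<subseteq> U" "U \<subseteq> {..<N}"
    then show "(\<Sum>A | A \<in> edge_sets N \<and> (\<exists>v\<in>U - S. edge_fires A S v). edge_rate beta N (card A)) =
        real (card U - card S) * fire_rate beta N (card S)"
      unfolding fire_rate_def by (rule sum_firing_edges)
  next
    \<comment> \<open>An edge that fires inside \<open>S\<close> is contained in \<open>S\<close>,
      so no vertex of it is left outside.\<close>
    show "\<not> edge_fires A S w" if "edge_fires A T v" "T \<subseteq> S" "v \<in> S - T" "w \<notin> S" for A S T v w
    proof -
      have "A \<subseteq> insert v T"
        using that(1) by (auto simp: edge_fires_def)
      then have "A - S = {}"
        using that by auto
      then show ?thesis
        unfolding edge_fires_def by (simp only: empty_not_insert not_False_eq_True)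
    qed
  qed (rule finite_edge_sets)
qed

text \<open>A vertex \<open>v\<close> with \<open>L (v, j) > 0\<close> joins as soon as \<open>j\<close> vertices are
  present: the smallest such \<open>j\<close> is the threshold of \<open>v\<close> in Sellke's construction.\<close>

definition level_fires :: "nat \<times> nat \<Rightarrow> nat set \<Rightarrow> nat \<Rightarrow> bool" where
  "level_fires p S v \<longleftrightarrow> fst p = v \<and> snd p \<le> card S"

text \<open>The rates are the increments of \<open>h\<close>, so that the rates of one vertex up to
  level \<open>n\<close> telescope to \<open>h n\<close>. The vertex then has threshold above
  \<open>n\<close> with probability \<open>exp (- h n)\<close>.\<close>

definition level_rate :: "(nat \<Rightarrow> real) \<Rightarrow> nat \<times> nat \<Rightarrow> real" where
  "level_rate h p = (if snd p = 0 then h 0 else h (snd p) - h (snd p - 1))"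

lemma sum_level_rate: "(\<Sum>j\<le>n. level_rate h (v, j)) = h n"
  by (induction n) (auto simp: level_rate_def)

text \<open>These are the vertices with threshold at most \<open>n\<close>. Distinct vertices use
  disjoint coordinates, so the size of this set is a sum of independent indicators under
  \<open>pois_prod\<close>.\<close>

definition reached :: "nat set \<Rightarrow> (nat \<times> nat \<Rightarrow> nat) \<Rightarrow> nat \<Rightarrow> nat set" where
  "reached V L n = {v \<in> V. \<exists>j\<le>n. L (v, j) > 0}"

locale levels =
  fixes V :: "nat set" and h :: "nat \<Rightarrow> real"
  assumes finV: "finite V" and h0: "h 0 \<ge> 0" and h_mono: "mono h"
begin

abbreviation "J \<equiv> V \<times> {..card V}"

lemma level_rate_nonneg: "level_rate h p \<ge> 0"
  using h0 monoD[OF h_mono, of "snd p - 1" "snd p"] by (auto simp: level_rate_def)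

text \<open>Each item targets a single vertex, which gives \<open>R_inner_outer\<close> directly.
  The items firing from \<open>S\<close> into \<open>U - S\<close> form the rectangle
  \<open>(U - S) \<times> {..card S}\<close>, and the rates telescope in each row.\<close>

sublocale random_firing level_fires V J "level_rate h" h
proof
  show "level_fires i T v" if "level_fires i S v" "S \<subseteq> T" "T \<subseteq> V" "v \<notin> T" for i S T v
    using that card_mono[of T S] finite_subset[OF that(3) finV] by (auto simp: level_fires_def)
next
  fix S U :: "nat set" assume SU: "S \<subseteq> U" "U \<subseteq> V"
  have fin: "finite S" "finite U"
    using SU by (auto intro: finite_subset[OF _ finV])
  have "card S \<le> card V"
    using SU finV by (intro card_mono) auto
  then have "{p \<in> J. \<exists>v\<in>U - S. level_fires p S v} = (U - S) \<times> {..card S}"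
    using SU by (auto simp: level_fires_def)
  then have "(\<Sum>p | p \<in> J \<and> (\<exists>v\<in>U - S. level_fires p S v). level_rate h p) =
      (\<Sum>(v, j)\<in>(U - S) \<times> {..card S}. level_rate h (v, j))"
    by simp
  also have "\<dots> = (\<Sum>v\<in>U - S. \<Sum>j\<le>card S. level_rate h (v, j))"
    by (rule sum.cartesian_product[symmetric])
  also have "\<dots> = real (card (U - S)) * h (card S)"
    by (simp add: sum_level_rate)
  finally show "(\<Sum>p | p \<in> J \<and> (\<exists>v\<in>U - S. level_fires p S v). level_rate h p) =
      real (card U - card S) * h (card S)"
    using SU fin by (simp add: card_Diff_subset)
qed (auto simp: level_rate_nonneg finV level_fires_def)

definition final :: "(nat \<times> nat \<Rightarrow> nat) \<Rightarrow> nat set" where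
  "final L = fire_closure level_fires (active J L) V"

text \<open>The rule sees \<open>S\<close> only through its size. Since
  \<open>card S \<le> card V\<close>, every level that matters belongs to the index set
  \<open>J\<close>.\<close>

lemma fire_closed_level_iff:
  assumes "S \<subseteq> V"
  shows "fire_closed level_fires (active J L) V S \<longleftrightarrow> reached V L (card S) \<subseteq> S"
proof -
  have "card S \<le> card V"
    using assms finV by (intro card_mono) auto
  then have "p \<in> J" if "fst p \<in> V" "snd p \<le> card S" for p
    using that by (cases p) auto
  then show ?thesis
    using assms unfolding fire_closed_def active_def reached_def level_fires_def
    by (auto simp del: mem_Sigma_iff, blast)
qed

lemma final_subset: "final L \<subseteq> V"
  unfolding final_def by (rule fire_closure_subset)

lemma card_reached_final: "card (reached V L (card (final L))) \<le> card (final L)"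
  using fire_closed_fire_closure[of V "active J L"] fire_closed_level_iff[OF final_subset]
    finite_subset[OF final_subset finV]
  by (intro card_mono) (auto simp: final_def)

text \<open>Padding the reached set to exactly \<open>n\<close> vertices gives a closed set, which
  contains the closure. With \<open>card_reached_final\<close>, the final size is the least
  \<open>n\<close> at which at most \<open>n\<close> vertices are reached.\<close>

lemma card_final_le:
  assumes "n \<le> card V" "card (reached V L n) \<le> n"
  shows "card (final L) \<le> n"
proof -
  have sub: "reached V L n \<subseteq> V"
    by (auto simp: reached_def)
  obtain S where S: "reached V L n \<subseteq> S" "S \<subseteq> V" "card S = n"
    using exists_subset_between[OF assms(2,1) sub finV] by metis
  then have "fire_closed level_fires (active J L) V S"
    by (simp add: fire_closed_level_iff)
  then have "final L \<subseteq> S"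
    unfolding final_def by (rule fire_closure_least)
  then show ?thesis
    using S finV by (metis card_mono finite_subset)
qed

lemma reached_mono: "m \<le> n \<Longrightarrow> reached V L m \<subseteq> reached V L n"
  unfolding reached_def using order_trans by fast

end

section \<open>Identifiable vertices as a closure\<close>

lemma edges_mset_iff: "B \<in># edges_mset N L \<longleftrightarrow> B \<subseteq> {..<N} \<and> L B > 0"
  by (auto simp: edges_mset_def set_mset_sum)

text \<open>If \<open>A - S = {v}\<close> with \<open>A\<close> inside the vertex set, then
  \<open>A\<close> is nonempty and \<open>v\<close> is a vertex outside \<open>S\<close>, so the
  side conditions in \<open>edge_sets\<close> and \<open>fire_closed\<close> hold
  automatically.\<close>

lemma fire_closed_edge_iff:
  "fire_closed edge_fires (active (edge_sets N) L) {..<N} S \<longleftrightarrow>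
    S \<subseteq> {..<N} \<and> (\<forall>A v. A \<subseteq> {..<N} \<longrightarrow> L A > 0 \<longrightarrow> A - S \<noteq> {v})"
proof -
  have "(\<forall>A\<in>active (edge_sets N) L. \<forall>v\<in>{..<N} - S. \<not> edge_fires A S v) \<longleftrightarrow>
      (\<forall>A v. A \<subseteq> {..<N} \<longrightarrow> L A > 0 \<longrightarrow> A - S \<noteq> {v})" (is "?l \<longleftrightarrow> ?r")
  proof
    assume l: ?l
    show ?r
    proof (intro allI impI notI)
      fix A v assume A: "A \<subseteq> {..<N}" "L A > 0" "A - S = {v}"
      then have "A \<in> active (edge_sets N) L" "v \<in> {..<N} - S"
        by (auto simp: active_def edge_sets_def)
      then show False
        using l A(3) by (auto simp: edge_fires_def)
    qed
  qed (auto simp: active_def edge_sets_def edge_fires_def)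
  then show ?thesis
    by (simp add: fire_closed_def)
qed

text \<open>Current edges are the original ones with \<open>S\<close> removed. An original edge that
  is no longer represented has been absorbed by \<open>S\<close>, which accounts for the patches
  consumed. The last clause bounds \<open>S\<close> by the closure.\<close>

lemma ident_invariant:
  assumes "ident_step\<^sup>*\<^sup>* (edges_mset N L, {}) (H, S)"
  shows "(\<forall>C\<in>#H. \<exists>B\<in>#edges_mset N L. C = B - S) \<and>
    (\<forall>B\<in>#edges_mset N L. B \<subseteq> S \<or> B - S \<in># H) \<and> S \<subseteq> patch_closure N L"
  using assms
proof (induction "(H, S)" arbitrary: H S rule: rtranclp_induct)
  case base
  then show ?case by auto
next
  case (step y)
  obtain H0 S0 where y: "y = (H0, S0)"
    by (cases y)
  obtain v where v: "{v} \<in># H0" "H = image_mset (\<lambda>B. B - {v}) (H0 - {#{v}#})" "S = insert v S0"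
    using step(2) unfolding y by (auto elim: ident_step.cases)
  note IH = step(3)[OF y]
  obtain B0 where B0: "B0 \<in># edges_mset N L" "{v} = B0 - S0"
    using IH v(1) by blast
  have cl: "fire_closed edge_fires (active (edge_sets N) L) {..<N} (patch_closure N L)"
    unfolding patch_closure_def by (rule firing_rule.fire_closed_fire_closure[OF firing_rule_edge[of N]]) simp
  \<comment> \<open>The patch at \<open>v\<close> is the remainder of an original edge
    \<open>B0\<close> after removing \<open>S0\<close>. As \<open>S0\<close> lies in the closure,
    \<open>B0\<close> would otherwise miss the closure exactly in \<open>v\<close>.\<close>
  have "v \<in> patch_closure N L"
  proof (rule ccontr)
    assume "v \<notin> patch_closure N L"
    then have "B0 - patch_closure N L = {v}"
      using B0 IH by blast
    then show False
      using cl B0(1) unfolding fire_closed_edge_iff edges_mset_iff by blast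
  qed
  moreover have "\<exists>B\<in>#edges_mset N L. C = B - S" if C: "C \<in># H" for C
  proof -
    obtain D where "D \<in># H0 - {#{v}#}" "C = D - {v}"
      using C unfolding v(2) by auto
    then have "D \<in># H0" "C = D - {v}"
      using in_diffD[of D H0] by auto
    moreover obtain B where "B \<in># edges_mset N L" "D = B - S0"
      using bspec[OF conjunct1[OF IH] \<open>D \<in># H0\<close>] by blast
    ultimately have "B \<in># edges_mset N L" "C = (B - S0) - {v}"
      by simp_all
    then show ?thesis
      using v(3) by (intro bexI[of _ B]) auto
  qed
  moreover have "B \<subseteq> S \<or> B - S \<in># H" if "B \<in># edges_mset N L" for B
  proof (cases "B \<subseteq> S")
    case False
    then have "B - S0 \<in># H0" "B - S0 \<noteq> {v}"
      using IH that v(3) by auto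
    \<comment> \<open>Only one copy of \<open>{v}\<close> was deleted, and the remainder of
      \<open>B\<close> differs from \<open>{v}\<close>, so it survives the deletion.\<close>
    then have "B - S0 \<in># H0 - {#{v}#}"
      by (simp add: in_diff_count)
    moreover have "B - S = (B - S0) - {v}"
      using v(3) by auto
    ultimately show ?thesis
      unfolding v(2) by auto
  qed simp
  ultimately show ?case
    using IH v(3) by blast
qed

text \<open>Every step consumes one patch, so the size of the multiset decreases strictly.\<close>

lemma ident_terminates:
  "\<exists>H' S'. ident_step\<^sup>*\<^sup>* (H, S) (H', S') \<and> ident_terminal (H', S')"
proof (induction "size H" arbitrary: H S rule: less_induct)
  case less
  show ?case
  proof (cases "ident_terminal (H, S)")
    case False
    then obtain v where v: "{v} \<in># H"
      by (auto simp: ident_terminal_def)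
    let ?H = "image_mset (\<lambda>B. B - {v}) (H - {#{v}#})"
    have "size ?H < size H"
      using size_Diff1_less[OF v] by simp
    from less[OF this, of "insert v S"] show ?thesis
      using ident_step.intros[OF v, of S] by (meson converse_rtranclp_into_rtranclp)
  qed auto
qed

text \<open>In a terminal state an edge missing \<open>S\<close> in one vertex would still be
  present as a patch. Hence \<open>S\<close> is closed and contains the least closed set; the
  invariant gives the other inclusion. All terminal states agree, so the choice operator returns
  this set.\<close>

lemma identifiable_eq_patch_closure: "identifiable N L = patch_closure N L"
proof -
  have "S = patch_closure N L" if S: "ident_step\<^sup>*\<^sup>* (edges_mset N L, {}) (H, S)" "ident_terminal (H, S)" for H S
  proof -
    note inv = ident_invariant[OF S(1)]
    have "A - S \<noteq> {v}" if A: "A \<subseteq> {..<N}" "L A > 0" for A v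
    proof
      assume eq: "A - S = {v}"
      have "A \<in># edges_mset N L"
        using A by (simp add: edges_mset_iff)
      then have "A \<subseteq> S \<or> A - S \<in># H"
        by (rule bspec[OF conjunct1[OF conjunct2[OF inv]]])
      then have "{v} \<in># H"
        using eq by auto
      then show False
        using S(2) by (auto simp: ident_terminal_def)
    qed
    moreover have "S \<subseteq> {..<N}"
      using inv firing_rule.fire_closure_subset[OF firing_rule_edge, of "active (edge_sets N) L" "{..<N}"]
      unfolding patch_closure_def by blast
    ultimately have "fire_closed edge_fires (active (edge_sets N) L) {..<N} S"
      unfolding fire_closed_edge_iff by blast
    then have "patch_closure N L \<subseteq> S"
      unfolding patch_closure_def by (rule firing_rule.fire_closure_least[OF firing_rule_edge])
    then show ?thesis
      using inv by blast
  qed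
  note eq = this
  show ?thesis
    unfolding identifiable_def
  proof (rule someI2_ex)
    show "\<exists>S H. ident_step\<^sup>*\<^sup>* (edges_mset N L, {}) (H, S) \<and> ident_terminal (H, S)"
      using ident_terminates by fast
  qed (elim exE conjE, rule eq)
qed

section \<open>Concentration of the number of identifiable vertices\<close>

lemma integrable_pmf_bounded:
  fixes f :: "'a \<Rightarrow> real"
  assumes "\<And>x. \<bar>f x\<bar> \<le> B"
  shows "integrable (measure_pmf p) f"
  by (rule measure_pmf.integrable_const_bound[where B = B]) (auto simp: assms)

lemma expectation_of_bool:
  "measure_pmf.expectation p (\<lambda>x. of_bool (P x)) = measure_pmf.prob p {x. P x}"
proof -
  have "(\<lambda>x. of_bool (P x) :: real) = indicat_real {x. P x}"
    by (auto simp: indicator_def)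
  then show ?thesis
    by simp
qed

lemma prob_ge_le_expectation:
  fixes f :: "'a \<Rightarrow> real"
  assumes "\<And>x. \<bar>f x\<bar> \<le> B" "\<And>x. f x \<ge> 0" "a > 0"
  shows "measure_pmf.prob p {x. f x \<ge> a} \<le> measure_pmf.expectation p f / a"
  using integral_Markov_inequality_measure[OF integrable_pmf_bounded[of f B p] _ _ assms(3), of "{}"] assms
  by simp

context levels
begin

text \<open>Chebyshev's inequality for the number of vertices not reached by level \<open>n\<close>,
  a sum of pairwise uncorrelated indicators \<open>Z v\<close> with variance at most 1.\<close>

lemma prob_card_reached_deviation:
  assumes "n \<le> card V" "a > 0"
  shows "measure_pmf.prob (pois_prod J (level_rate h))
    {L. \<bar>real (card (reached V L n)) - real (card V) * (1 - exp (- h n))\<bar> \<ge> a} \<le> real (card V) / a\<^sup>2"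
proof -
  let ?P = "pois_prod J (level_rate h)"
  let ?E = "measure_pmf.expectation ?P"
  define q where "q = exp (- h n)"
  define Z :: "nat \<Rightarrow> (nat \<times> nat \<Rightarrow> nat) \<Rightarrow> real"
    where "Z v L = of_bool (\<forall>p\<in>{v} \<times> {..n}. L p = 0)" for v L
  have hn: "h n \<ge> 0"
    using h0 monoD[OF h_mono, of 0 n] by simp
  have q: "0 \<le> q" "q \<le> 1"
    using hn by (auto simp: q_def)
  have Z01: "0 \<le> Z v L" "Z v L \<le> 1" for v L
    by (auto simp: Z_def)
  \<comment> \<open>Stated for a set \<open>W\<close> of vertices, so that one and two vertices give
    the first and the mixed moments.\<close>
  have vac: "measure_pmf.prob ?P {L. \<forall>p\<in>W \<times> {..n}. L p = 0} = q ^ card W" if "W \<subseteq> V" for W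
  proof -
    have "measure_pmf.prob ?P {L. \<forall>p\<in>W \<times> {..n}. L p = 0} = exp (- (\<Sum>p\<in>W \<times> {..n}. level_rate h p))"
      by (rule prob_pois_prod_vacant) (use that assms finite_I level_rate_nonneg in auto)
    also have "(\<Sum>p\<in>W \<times> {..n}. level_rate h p) = (\<Sum>v\<in>W. \<Sum>j\<le>n. level_rate h (v, j))"
      by (simp add: sum.cartesian_product)
    also have "\<dots> = real (card W) * h n"
      by (simp add: sum_level_rate)
    finally show ?thesis
      by (simp add: q_def exp_of_nat_mult[symmetric])
  qed
  have EZ: "?E (Z v) = q" if "v \<in> V" for v
    using vac[of "{v}"] that unfolding Z_def by (subst expectation_of_bool) simp
  \<comment> \<open>The exponent \<open>card {v, w}\<close> covers the diagonal as well, where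
    \<open>Z v\<close> is idempotent.\<close>
  have EZZ: "?E (\<lambda>L. Z v L * Z w L) = q ^ card {v, w}" if "v \<in> V" "w \<in> V" for v w
  proof -
    have "(\<lambda>L. Z v L * Z w L) = (\<lambda>L. of_bool (\<forall>p\<in>{v, w} \<times> {..n}. L p = 0))"
      by (auto simp: Z_def fun_eq_iff)
    then show ?thesis
      using vac[of "{v, w}"] that by (simp only: expectation_of_bool) simp
  qed
  have intZ: "integrable ?P (Z v)" for v
    by (rule integrable_pmf_bounded[where B = 1]) (use Z01 in auto)
  have intZZ: "integrable ?P (\<lambda>L. Z v L * Z w L)" for v w
    by (rule integrable_pmf_bounded[where B = 1])
       (use Z01 in \<open>auto simp: abs_mult intro!: mult_le_one\<close>)
  have cov: "?E (\<lambda>L. (Z v L - q) * (Z w L - q)) = (if v = w then q - q\<^sup>2 else 0)"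
    if "v \<in> V" "w \<in> V" for v w
  proof -
    have "?E (\<lambda>L. (Z v L - q) * (Z w L - q)) =
        ?E (\<lambda>L. Z v L * Z w L - q * Z v L - q * Z w L + q\<^sup>2)"
      by (intro arg_cong[where f = ?E]) (auto simp: fun_eq_iff algebra_simps power2_eq_square)
    also have "\<dots> = q ^ card {v, w} - q * q - q * q + q\<^sup>2"
      using intZ intZZ EZ EZZ that by simp
    finally show ?thesis
      using card_2_iff[of "{v, w}"] by (auto simp: power2_eq_square)
  qed
  have Zint': "integrable ?P (\<lambda>L. (Z v L - q) * (Z w L - q))" for v w
  proof (rule integrable_pmf_bounded[where B = 1])
    fix L
    have "\<bar>Z v L - q\<bar> \<le> 1" "\<bar>Z w L - q\<bar> \<le> 1"
      using Z01[of v L] Z01[of w L] q by auto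
    then show "\<bar>(Z v L - q) * (Z w L - q)\<bar> \<le> 1"
      by (simp add: abs_mult mult_le_one)
  qed
  define Y where "Y L = (\<Sum>v\<in>V. Z v L - q)" for L
  have "?E (\<lambda>L. (Y L)\<^sup>2) = (\<Sum>v\<in>V. \<Sum>w\<in>V. ?E (\<lambda>L. (Z v L - q) * (Z w L - q)))"
    unfolding Y_def power2_eq_square sum_product by (simp add: Zint' Bochner_Integration.integral_sum)
  also have "\<dots> = (\<Sum>v\<in>V. q - q\<^sup>2)"
    by (intro sum.cong) (auto simp: cov finV)
  also have "\<dots> \<le> (\<Sum>v\<in>V. 1)"
    using q zero_le_power2[of q] by (intro sum_mono) linarith
  finally have EY: "?E (\<lambda>L. (Y L)\<^sup>2) \<le> real (card V)"
    by simp
  have Yabs: "\<bar>Y L\<bar> \<le> real (card V)" for L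
  proof -
    have "\<bar>Y L\<bar> \<le> (\<Sum>v\<in>V. \<bar>Z v L - q\<bar>)"
      unfolding Y_def by (rule sum_abs)
    also have "\<dots> \<le> (\<Sum>v\<in>V. 1)"
    proof (rule sum_mono)
      show "\<bar>Z v L - q\<bar> \<le> 1" for v
        using Z01[of v L] q by linarith
    qed
    finally show ?thesis
      by simp
  qed
  have reached_eq: "real (card (reached V L n)) - real (card V) * (1 - q) = - Y L" for L
  proof -
    have "(\<Sum>v\<in>V. Z v L) = (\<Sum>v\<in>V. if v \<in> V - reached V L n then 1 else 0)"
      by (intro sum.cong) (auto simp: Z_def reached_def)
    also have "\<dots> = real (card (V - reached V L n))"
      using finV by (simp only: sum.If_cases Int_absorb1 Collect_mem_eq Diff_subset) simp
    also have "\<dots> = real (card V) - real (card (reached V L n))"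
      using finV card_mono[OF finV, of "reached V L n"]
      by (subst card_Diff_subset) (auto simp: reached_def)
    finally show ?thesis
      by (simp add: Y_def sum_subtractf algebra_simps)
  qed
  have "measure_pmf.prob ?P {L. \<bar>real (card (reached V L n)) - real (card V) * (1 - exp (- h n))\<bar> \<ge> a} =
      measure_pmf.prob ?P {L. (Y L)\<^sup>2 \<ge> a\<^sup>2}"
    unfolding reached_eq[unfolded q_def]
    using assms(2) abs_le_square_iff[of a] by (intro arg_cong[where f = "measure_pmf.prob _"]) auto
  also have "\<dots> \<le> ?E (\<lambda>L. (Y L)\<^sup>2) / a\<^sup>2"
    using assms(2) Yabs
    by (intro prob_ge_le_expectation[where B = "(real (card V))\<^sup>2"])
       (auto simp: abs_le_square_iff[symmetric])
  also have "\<dots> \<le> real (card V) / a\<^sup>2"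
    using EY by (intro divide_right_mono) auto
  finally show ?thesis .
qed

end

text \<open>The ratio is a product of \<open>j\<close> factors, each tending to \<open>t\<close>
  after division by \<open>n x\<close>. The filter is arbitrary because the limit is needed both
  along \<open>N\<close> and on pairs of \<open>N\<close> and a set size.\<close>

lemma binomial_ratio_tendsto:
  fixes s n :: "'a \<Rightarrow> nat"
  assumes n: "filterlim n at_top F" and s: "((\<lambda>x. real (s x) / real (n x)) \<longlongrightarrow> t) F"
  shows "((\<lambda>x. real (s x choose j) / real (n x - 1 choose j)) \<longlongrightarrow> t ^ j) F"
proof -
  have inv: "((\<lambda>x. c / real (n x)) \<longlongrightarrow> 0) F" for c
    by (rule tendsto_divide_0[OF tendsto_const])
       (intro filterlim_at_top_imp_at_infinity filterlim_compose[OF filterlim_real_sequentially n])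
  have "((\<lambda>x. \<Prod>i<j. (real (s x) / real (n x) - real i / real (n x)) / (1 - (1 + real i) / real (n x)))
      \<longlongrightarrow> (\<Prod>i<j. (t - 0) / (1 - 0))) F"
    by (intro tendsto_prod tendsto_divide tendsto_diff s inv tendsto_const) simp
  moreover have "\<forall>\<^sub>F x in F. (\<Prod>i<j. (real (s x) / real (n x) - real i / real (n x)) / (1 - (1 + real i) / real (n x))) =
      real (s x choose j) / real (n x - 1 choose j)"
  proof -
    have "\<forall>\<^sub>F x in F. n x \<ge> 1"
      using n by (simp add: filterlim_at_top)
    then show ?thesis
    proof eventually_elim
      case (elim x)
      have "(real (s x) / real (n x) - real i / real (n x)) / (1 - (1 + real i) / real (n x)) =
          (real (s x) - real i) / (real (n x - 1) - real i)" for i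
      proof -
        have "(real (s x) / real (n x) - real i / real (n x)) = (real (s x) - real i) / real (n x)"
          by (simp add: diff_divide_distrib)
        moreover have "1 - (1 + real i) / real (n x) = (real (n x - 1) - real i) / real (n x)"
          using elim by (simp add: field_simps of_nat_diff)
        ultimately show ?thesis
          using elim by simp
      qed
      then show ?case
        by (simp add: binomial_gbinomial gbinomial_prod_rev prod_dividef lessThan_atLeast0)
    qed
  qed
  ultimately show ?thesis
    by (simp add: tendsto_cong)
qed

section \<open>The derivative series and the limit of the firing rates\<close>

locale hypergraph_params =
  fixes beta :: "nat \<Rightarrow> real"
  assumes nonneg: "\<And>k. k \<ge> 1 \<Longrightarrow> beta k \<ge> 0"
    and summ: "summable (\<lambda>k. real (Suc k) * beta (Suc k))"
begin

definition dbeta :: "real \<Rightarrow> real" where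
  "dbeta t = (\<Sum>j. real (Suc j) * beta (Suc j) * t ^ j)"

lemma summable_beta: "summable (\<lambda>k. beta (Suc k))"
proof (rule summable_comparison_test'[OF summ, of 0])
  show "norm (beta (Suc n)) \<le> real (Suc n) * beta (Suc n)" for n
    using nonneg[of "Suc n"] mult_right_mono[of 1 "real (Suc n)" "beta (Suc n)"] by simp
qed

lemma summable_dbeta: "\<bar>t\<bar> \<le> 1 \<Longrightarrow> summable (\<lambda>j. real (Suc j) * beta (Suc j) * t ^ j)"
  by (rule summable_comparison_test'[OF summ, of 0])
     (use nonneg in \<open>auto simp: abs_mult power_abs intro!: mult_right_le_one_le power_le_one\<close>)

lemma deriv_beta_fun:
  assumes "\<bar>t\<bar> < 1"
  shows "deriv (beta_fun beta) t = dbeta t"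
proof -
  \<comment> \<open>\<open>beta_fun\<close> starts at exponent 1, so as a power series it has
    constant coefficient 0.\<close>
  define c where "c n = (if n = 0 then 0 else beta n)" for n
  have summable_c: "summable (\<lambda>n. c n * z ^ n)" if "norm z < 1" for z :: real
  proof (subst summable_Suc_iff[symmetric], rule summable_comparison_test'[OF summable_beta, of 0])
    fix n
    have "\<bar>z\<bar> ^ Suc n \<le> 1"
      using that by (intro power_le_one) auto
    then have "beta (Suc n) * \<bar>z\<bar> ^ Suc n \<le> beta (Suc n) * 1"
      using nonneg by (intro mult_left_mono) auto
    then show "norm (c (Suc n) * z ^ Suc n) \<le> beta (Suc n)"
      using nonneg[of "Suc n"] by (simp add: c_def abs_mult power_abs)
  qed
  have "((\<lambda>z. \<Sum>n. c n * z ^ n) has_field_derivative (\<Sum>n. diffs c n * t ^ n)) (at t)"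
    by (rule termdiffs_strong'[where K = 1]) (use summable_c assms in auto)
  moreover have "(\<Sum>n. diffs c n * t ^ n) = dbeta t"
    by (simp add: diffs_def dbeta_def c_def)
  moreover have "(\<Sum>n. c n * z ^ n) = beta_fun beta z" if "norm z < 1" for z
    using suminf_split_head[OF summable_c[OF that]] by (simp add: beta_fun_def c_def)
  then have "\<forall>\<^sub>F z in nhds t. (\<Sum>n. c n * z ^ n) = beta_fun beta z"
    using assms by (intro eventually_nhds_in_open[of "ball 0 1", THEN eventually_mono]) auto
  ultimately have "(beta_fun beta has_field_derivative dbeta t) (at t)"
    by (subst (asm) DERIV_cong_ev[OF refl _ refl]) auto
  then show ?thesis
    by (rule DERIV_imp_deriv)
qed

lemma isCont_dbeta:
  assumes "\<bar>t\<bar> < 1"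
  shows "isCont dbeta t"
  unfolding dbeta_def
  by (rule isCont_powser[where K = 1]) (use summable_dbeta[of 1] assms in auto)

lemma dbeta_le: "0 \<le> t \<Longrightarrow> t \<le> 1 \<Longrightarrow> dbeta t \<le> (\<Sum>k. real (Suc k) * beta (Suc k))"
  unfolding dbeta_def
  by (rule suminf_le)
     (use summable_dbeta[of t] summ nonneg in \<open>auto intro!: mult_right_le_one_le power_le_one\<close>)

lemma edge_rate_ge_0: "edge_rate beta N (Suc j) \<ge> 0"
  using nonneg by (intro edge_rate_nonneg) auto

lemma fire_rate_mono: "mono (fire_rate beta N)"
proof (rule monoI)
  fix m n :: nat assume mn: "m \<le> n"
  have "fire_rate beta N m \<le> (\<Sum>j\<le>m. real (n choose j) * edge_rate beta N (Suc j))"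
    unfolding fire_rate_def using edge_rate_ge_0 mn
    by (intro sum_mono mult_right_mono) (auto intro: binomial_right_mono)
  also have "\<dots> \<le> fire_rate beta N n"
    unfolding fire_rate_def using edge_rate_ge_0 mn by (intro sum_mono2) auto
  finally show "fire_rate beta N m \<le> fire_rate beta N n" .
qed

lemma edge_rate_Suc:
  assumes "N \<ge> 1"
  shows "edge_rate beta N (Suc j) = real (Suc j) * beta (Suc j) / real (N - 1 choose j)"
proof (cases "Suc j \<le> N")
  case True
  have "real (Suc j) * real (N choose Suc j) = real N * real (N - 1 choose j)"
    using Suc_times_binomial_eq[of "N - 1" j] assms unfolding of_nat_mult[symmetric]
    by (simp add: mult.commute)
  then have "real N * beta (Suc j) * real (N - 1 choose j) =
      real (Suc j) * beta (Suc j) * real (N choose Suc j)"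
    by (metis mult.assoc mult.commute)
  moreover have "real (N choose Suc j) \<noteq> 0" "real (N - 1 choose j) \<noteq> 0"
    using True by auto
  ultimately show ?thesis
    unfolding edge_rate_def by (intro iffD2[OF frac_eq_eq])
next
  \<comment> \<open>Here both binomial coefficients vanish, and division by zero makes both sides
    0.\<close>
  case False
  then show ?thesis
    using assms by (simp add: edge_rate_def binomial_eq_0)
qed

text \<open>Tannery's theorem, that is, dominated convergence for series. Since
  \<open>t < 1\<close>, the floor of \<open>t * real N\<close> is at most \<open>N - 1\<close>, so
  the binomial ratios are at most 1 and the summable sequence of \<open>summ\<close>
  dominates.\<close>

lemma fire_rate_tendsto:
  assumes t: "0 \<le> t" "t < 1"
  shows "(\<lambda>N. fire_rate beta N (nat \<lfloor>t * real N\<rfloor>)) \<longlonglongrightarrow> dbeta t"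
proof -
  define n where "n N = nat \<lfloor>t * real N\<rfloor>" for N
  define a where "a j N = real (Suc j) * beta (Suc j) * (real (n N choose j) / real (N - 1 choose j))" for j N
  have n_less: "n N \<le> N - 1" if "N \<ge> 1" for N
  proof -
    have "t * real N < real N"
      using t that by simp
    then have "n N < N"
      using t unfolding n_def by (simp add: nat_less_iff floor_less_iff)
    then show ?thesis
      by simp
  qed
  have lim: "a j \<longlonglongrightarrow> real (Suc j) * beta (Suc j) * t ^ j" for j
  proof -
    have "(\<lambda>N. real (n N) / real N) \<longlonglongrightarrow> t"
    proof (rule tendsto_sandwich)
      show "\<forall>\<^sub>F N in sequentially. t - 1 / real N \<le> real (n N) / real N"
        using eventually_gt_at_top[of 0]
      proof eventually_elim
        case (elim N)
        have "t * real N - 1 \<le> real (n N)"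
          unfolding n_def by linarith
        then have "(t * real N - 1) / real N \<le> real (n N) / real N"
          by (intro divide_right_mono) auto
        then show ?case
          using elim by (simp add: diff_divide_distrib)
      qed
      show "\<forall>\<^sub>F N in sequentially. real (n N) / real N \<le> t"
        using eventually_gt_at_top[of 0]
      proof eventually_elim
        case (elim N)
        have "real (n N) \<le> t * real N"
          using t unfolding n_def by (simp add: of_nat_nat)
        then show ?case
          using elim by (simp add: field_simps)
      qed
      show "(\<lambda>N. t - 1 / real N) \<longlonglongrightarrow> t"
        using tendsto_diff[OF tendsto_const lim_1_over_n, of t] by simp
    qed simp
    then show ?thesis
      unfolding a_def by (intro tendsto_mult tendsto_const binomial_ratio_tendsto filterlim_ident)
  qed
  have bound: "norm (a j N) \<le> real (Suc j) * beta (Suc j)" if "N \<ge> 1" for j N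
  proof -
    have "real (n N choose j) \<le> real (N - 1 choose j)"
      using n_less[OF that] by (simp add: binomial_right_mono)
    then have "real (n N choose j) / real (N - 1 choose j) \<le> 1"
      by (simp add: divide_le_eq_1) linarith
    then have "real (Suc j) * beta (Suc j) * (real (n N choose j) / real (N - 1 choose j)) \<le> real (Suc j) * beta (Suc j) * 1"
      using nonneg by (intro mult_left_mono) auto
    then show ?thesis
      using nonneg[of "Suc j"] by (simp add: a_def abs_mult)
  qed
  have "(\<lambda>N. \<Sum>j. a j N) \<longlonglongrightarrow> dbeta t"
    unfolding dbeta_def
  proof (intro tannerys_theorem[THEN conjunct2, THEN conjunct2])
    have "\<forall>\<^sub>F x in at_top \<times>\<^sub>F sequentially. True \<and> 1 \<le> snd x"
      by (rule eventually_prodI[of "\<lambda>_. True"]) (auto intro: eventually_ge_at_top)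
    then show "\<forall>\<^sub>F (j, N) in at_top \<times>\<^sub>F sequentially. norm (a j N) \<le> real (Suc j) * beta (Suc j)"
      by eventually_elim (use bound in auto)
  qed (use lim summ in auto)
  moreover have "\<forall>\<^sub>F N in sequentially. (\<Sum>j. a j N) = fire_rate beta N (n N)"
    using eventually_ge_at_top[of 1]
  proof eventually_elim
    case (elim N)
    have "(\<Sum>j. a j N) = (\<Sum>j\<le>n N. a j N)"
      by (rule suminf_finite) (auto simp: a_def binomial_eq_0)
    also have "\<dots> = fire_rate beta N (n N)"
      unfolding fire_rate_def a_def edge_rate_Suc[OF elim] by (intro sum.cong) auto
    finally show ?case .
  qed
  ultimately show ?thesis
    unfolding n_def by (simp add: tendsto_cong)
qed

section \<open>Transfer to the threshold system and its final size\<close>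

lemma levels_fire_rate: "levels {..<N} (fire_rate beta N)"
proof
  show "0 \<le> fire_rate beta N 0"
    using edge_rate_ge_0[of N 0] by (simp add: fire_rate_def)
qed (auto intro: fire_rate_mono)

text \<open>\<open>card {..<N}\<close> is left unsimplified to match the index set \<open>J\<close>
  of the locale \<open>levels\<close>.\<close>

definition level_pmf :: "nat \<Rightarrow> (nat \<times> nat \<Rightarrow> nat) pmf" where
  "level_pmf N = pois_prod ({..<N} \<times> {..card {..<N}}) (level_rate (fire_rate beta N))"

definition level_final :: "nat \<Rightarrow> (nat \<times> nat \<Rightarrow> nat) \<Rightarrow> nat set" where
  "level_final N = levels.final {..<N}"

text \<open>Both systems have the rate function \<open>fire_rate beta N\<close>, so their closures
  have the same law and the thresholds can replace the hypergraph.\<close>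

lemma prob_patch_closure:
  "measure_pmf.prob (poisson_hypergraph beta N) {L. Q (patch_closure N L)} =
    measure_pmf.prob (level_pmf N) {L. Q (level_final N L)}"
proof -
  interpret levels "{..<N}" "fire_rate beta N"
    by (rule levels_fire_rate)
  show ?thesis
    unfolding poisson_hypergraph_eq patch_closure_def level_pmf_def level_final_def final_def
    by (rule random_firing_law_unique[OF random_firing_edge[OF nonneg] random_firing_axioms])
qed

text \<open>The deviation is split in two halves: \<open>fire_rate_tendsto\<close> makes the bias at
  most \<open>d / 2 * real N\<close>, and Chebyshev's inequality bounds the fluctuation by
  \<open>4 / d^2 / N\<close>.\<close>

lemma card_reached_concentrated:
  assumes t: "0 \<le> t" "t < 1" and d: "d > 0"
  shows "(\<lambda>N. measure_pmf.prob (level_pmf N) {L. d * real N \<le>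
    \<bar>real (card (reached {..<N} L (nat \<lfloor>t * real N\<rfloor>))) - real N * (1 - exp (- dbeta t))\<bar>}) \<longlonglongrightarrow> 0"
proof (rule tendsto_sandwich[OF _ _ tendsto_const])
  let ?n = "\<lambda>N. nat \<lfloor>t * real N\<rfloor>"
  have "(\<lambda>N. exp (- fire_rate beta N (?n N))) \<longlonglongrightarrow> exp (- dbeta t)"
    using fire_rate_tendsto[OF t] by (intro tendsto_intros)
  from tendstoD[OF this half_gt_zero[OF d]]
  have ev: "\<forall>\<^sub>F N in sequentially. \<bar>exp (- fire_rate beta N (?n N)) - exp (- dbeta t)\<bar> < d / 2"
    unfolding dist_real_def .
  show "\<forall>\<^sub>F N in sequentially. measure_pmf.prob (level_pmf N) {L. d * real N \<le>
    \<bar>real (card (reached {..<N} L (?n N))) - real N * (1 - exp (- dbeta t))\<bar>} \<le> (4 / d\<^sup>2) * (1 / real N)"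
    using ev eventually_gt_at_top[of 0]
  proof eventually_elim
    case (elim N)
    interpret levels "{..<N}" "fire_rate beta N"
      by (rule levels_fire_rate)
    have "t * real N \<le> 1 * real N"
      using t by (intro mult_right_mono) auto
    then have n: "?n N \<le> card {..<N}"
      by (simp add: nat_le_iff floor_le_iff)
    have "real N * \<bar>exp (- fire_rate beta N (?n N)) - exp (- dbeta t)\<bar> \<le> real N * (d / 2)"
      using elim by (intro mult_left_mono) auto
    then have close: "\<bar>real N * (1 - exp (- fire_rate beta N (?n N))) - real N * (1 - exp (- dbeta t))\<bar> \<le> d / 2 * real N"
      by (simp add: right_diff_distrib[symmetric] abs_mult abs_minus_commute mult.commute)
    have "measure_pmf.prob (level_pmf N) {L. d * real N \<le>
        \<bar>real (card (reached {..<N} L (?n N))) - real N * (1 - exp (- dbeta t))\<bar>} \<le>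
      measure_pmf.prob (level_pmf N) {L. d / 2 * real N \<le>
        \<bar>real (card (reached {..<N} L (?n N))) - real N * (1 - exp (- fire_rate beta N (?n N)))\<bar>}"
    proof (intro measure_pmf.finite_measure_mono Collect_mono impI)
      have tri: "D \<le> \<bar>x - y\<bar> \<Longrightarrow> D / 2 \<le> \<bar>x - z\<bar>" if "\<bar>z - y\<bar> \<le> D / 2" for x y z D :: real
        using that by linarith
      fix L
      assume "d * real N \<le> \<bar>real (card (reached {..<N} L (?n N))) - real N * (1 - exp (- dbeta t))\<bar>"
      from tri[OF _ this] close show "d / 2 * real N \<le>
          \<bar>real (card (reached {..<N} L (?n N))) - real N * (1 - exp (- fire_rate beta N (?n N)))\<bar>"
        by simp
    qed simp
    also have "\<dots> \<le> real N / (d / 2 * real N)\<^sup>2"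
      using prob_card_reached_deviation[OF n, of "d / 2 * real N"] d elim
      by (simp add: level_pmf_def)
    also have "\<dots> = (4 / d\<^sup>2) * (1 / real N)"
      using elim d by (simp add: power2_eq_square field_simps)
    finally show ?case .
  qed
  show "(\<lambda>N. 4 / d\<^sup>2 * (1 / real N)) \<longlonglongrightarrow> 0"
    using tendsto_mult[OF tendsto_const lim_1_over_n, of "4 / d\<^sup>2"] by simp
qed simp

text \<open>The sign condition means \<open>1 - exp (- dbeta t) < t\<close>. A final size above
  \<open>t * real N\<close> would force at least that many reached vertices at this level, exceeding
  the typical number by a fixed fraction of \<open>N\<close>.\<close>

lemma level_final_upper:
  assumes t: "0 \<le> t" "t < 1" and neg: "dbeta t + ln (1 - t) < 0"
  shows "(\<lambda>N. measure_pmf.prob (level_pmf N) {L. real (card (level_final N L)) > t * real N}) \<longlonglongrightarrow> 0"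
proof -
  define d where "d = t - (1 - exp (- dbeta t))"
  have "ln (1 - t) < - dbeta t"
    using neg by simp
  then have "exp (ln (1 - t)) < exp (- dbeta t)"
    by simp
  then have d: "d > 0"
    using t by (simp add: d_def)
  show ?thesis
  proof (rule tendsto_sandwich[OF _ _ tendsto_const card_reached_concentrated[OF t d]])
    show "\<forall>\<^sub>F N in sequentially.
      measure_pmf.prob (level_pmf N) {L. real (card (level_final N L)) > t * real N} \<le>
      measure_pmf.prob (level_pmf N) {L. d * real N \<le>
        \<bar>real (card (reached {..<N} L (nat \<lfloor>t * real N\<rfloor>))) - real N * (1 - exp (- dbeta t))\<bar>}"
    proof (intro always_eventually allI measure_pmf.finite_measure_mono subsetI)
      fix N L
      interpret levels "{..<N}" "fire_rate beta N"
        by (rule levels_fire_rate)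
      let ?n = "nat \<lfloor>t * real N\<rfloor>"
      assume "L \<in> {L. real (card (level_final N L)) > t * real N}"
      then have gt: "real (card (level_final N L)) > t * real N"
        by simp
      have "t * real N \<le> 1 * real N"
        using t by (intro mult_right_mono) auto
      then have n: "?n \<le> card {..<N}"
        by (simp add: nat_le_iff floor_le_iff)
      have tN: "0 \<le> t * real N"
        using t by simp
      have "\<not> card (final L) \<le> ?n"
        using gt tN unfolding level_final_def by linarith
      then have "card (reached {..<N} L ?n) > ?n"
        using card_final_le[OF n] by force
      then have "real (card (reached {..<N} L ?n)) \<ge> t * real N"
        using tN by linarith
      then show "L \<in> {L. d * real N \<le> \<bar>real (card (reached {..<N} L ?n)) - real N * (1 - exp (- dbeta t))\<bar>}"
        by (simp add: d_def algebra_simps)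
    qed simp
  qed simp
qed

text \<open>A bootstrap: once the final density is at least \<open>t\<close>, the final set contains
  all vertices reached at level \<open>t * real N\<close>, whose density is close to
  \<open>1 - exp (- dbeta t)\<close>.\<close>

lemma level_final_lower_step:
  assumes t: "0 \<le> t" "t < 1" and u: "u < 1 - exp (- dbeta t)"
    and lim: "(\<lambda>N. measure_pmf.prob (level_pmf N) {L. real (card (level_final N L)) < t * real N}) \<longlonglongrightarrow> 0"
  shows "(\<lambda>N. measure_pmf.prob (level_pmf N) {L. real (card (level_final N L)) < u * real N}) \<longlonglongrightarrow> 0"
proof -
  define d where "d = 1 - exp (- dbeta t) - u"
  have d: "d > 0"
    using u by (simp add: d_def)
  show ?thesis
  proof (rule tendsto_sandwich[OF _ _ tendsto_const
        tendsto_add_zero[OF lim card_reached_concentrated[OF t d]]])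
    show "\<forall>\<^sub>F N in sequentially.
      measure_pmf.prob (level_pmf N) {L. real (card (level_final N L)) < u * real N} \<le>
      measure_pmf.prob (level_pmf N) {L. real (card (level_final N L)) < t * real N} +
      measure_pmf.prob (level_pmf N) {L. d * real N \<le>
        \<bar>real (card (reached {..<N} L (nat \<lfloor>t * real N\<rfloor>))) - real N * (1 - exp (- dbeta t))\<bar>}"
    proof (intro always_eventually allI order_trans[OF measure_pmf.finite_measure_mono
          measure_Un_le] subsetI)
      fix N L
      interpret levels "{..<N}" "fire_rate beta N"
        by (rule levels_fire_rate)
      let ?n = "nat \<lfloor>t * real N\<rfloor>"
      assume "L \<in> {L. real (card (level_final N L)) < u * real N}"
      then have less: "real (card (final L)) < u * real N"
        by (simp add: level_final_def)
      have "d * real N \<le> \<bar>real (card (reached {..<N} L ?n)) - real N * (1 - exp (- dbeta t))\<bar>"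
        if "\<not> real (card (final L)) < t * real N"
      proof -
        have "?n \<le> card (final L)"
          using that by linarith
        then have "card (reached {..<N} L ?n) \<le> card (reached {..<N} L (card (final L)))"
          by (intro card_mono reached_mono) (auto simp: reached_def)
        also have "\<dots> \<le> card (final L)"
          by (rule card_reached_final)
        finally have "real (card (reached {..<N} L ?n)) < u * real N"
          using less by linarith
        then show ?thesis
          by (simp add: d_def algebra_simps)
      qed
      then show "L \<in> {L. real (card (level_final N L)) < t * real N} \<union> {L. d * real N \<le>
          \<bar>real (card (reached {..<N} L ?n)) - real N * (1 - exp (- dbeta t))\<bar>}"
        by (auto simp: level_final_def)
    qed auto
  qed simp
qed

text \<open>On the compact interval the gain \<open>phi\<close> has a positive minimum
  \<open>phi x\<close>. Each bootstrap step raises the bound by half of it, the other half giving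
  the strict inequality; finitely many steps reach \<open>s\<close>.\<close>

lemma level_final_lower:
  assumes s: "0 \<le> s" "s < 1" and pos: "\<And>t. 0 \<le> t \<Longrightarrow> t \<le> s \<Longrightarrow> dbeta t + ln (1 - t) > 0"
  shows "(\<lambda>N. measure_pmf.prob (level_pmf N) {L. real (card (level_final N L)) < s * real N}) \<longlonglongrightarrow> 0"
proof -
  define phi where "phi t = 1 - exp (- dbeta t) - t" for t
  have "continuous_on {0..s} phi"
    unfolding phi_def
    using s by (intro continuous_intros continuous_at_imp_continuous_on ballI isCont_dbeta) auto
  then obtain x where x: "x \<in> {0..s}" "\<And>t. t \<in> {0..s} \<Longrightarrow> phi x \<le> phi t"
    using continuous_attains_inf[of "{0..s}" phi] s by auto
  have "- dbeta x < ln (1 - x)"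
    using pos[of x] x by simp
  then have "exp (- dbeta x) < exp (ln (1 - x))"
    by (simp only: exp_less_cancel_iff)
  also have "exp (ln (1 - x)) = 1 - x"
    using x s by simp
  finally have d: "phi x > 0"
    by (simp add: phi_def)
  have step: "(\<lambda>N. measure_pmf.prob (level_pmf N)
      {L. real (card (level_final N L)) < min s (real i * (phi x / 2)) * real N}) \<longlonglongrightarrow> 0" for i
  proof (induction i)
    case 0
    have "\<not> real (card (level_final N L)) < min s (real 0 * (phi x / 2)) * real N" for N L
      using s by (simp add: min_def)
    then show ?case
      by simp
  next
    case (Suc i)
    let ?t = "min s (real i * (phi x / 2))"
    have t: "?t \<in> {0..s}"
      using s d by auto
    have "min s (real (Suc i) * (phi x / 2)) \<le> ?t + phi x / 2"
      using d by (auto simp: min_def algebra_simps)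
    also have "\<dots> < ?t + phi ?t"
      using x(2)[OF t] d by linarith
    finally have "min s (real (Suc i) * (phi x / 2)) < 1 - exp (- dbeta ?t)"
      by (simp add: phi_def)
    then show ?case
      using t s by (intro level_final_lower_step[OF _ _ _ Suc]) auto
  qed
  obtain i where "s / (phi x / 2) < real i"
    using reals_Archimedean2 by blast
  then have "min s (real i * (phi x / 2)) = s"
    using d by (simp add: field_simps min_def)
  then show ?thesis
    using step[of i] by simp
qed

section \<open>The fixed point\<close>

definition ts :: real where
  "ts = tstar beta"

lemma ts_set_nonempty: "{t. 0 \<le> t \<and> t < 1 \<and> deriv (beta_fun beta) t + ln (1 - t) < 0} \<noteq> {}"
proof -
  define B where "B = (\<Sum>k. real (Suc k) * beta (Suc k))"
  \<comment> \<open>Chosen so that \<open>ln (1 - t) = - (B + 1)\<close>, which outweighs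
    \<open>dbeta t \<le> B\<close>.\<close>
  define t where "t = 1 - exp (- (B + 1))"
  have "B \<ge> 0"
    unfolding B_def using nonneg summ by (intro suminf_nonneg) auto
  then have t: "0 \<le> t" "t < 1"
    by (auto simp: t_def)
  have "dbeta t \<le> B"
    using dbeta_le[of t] t by (simp add: B_def)
  then have "deriv (beta_fun beta) t + ln (1 - t) < 0"
    using t by (simp add: deriv_beta_fun) (simp add: t_def)
  then show ?thesis
    using t by blast
qed

lemma ts_range: "0 \<le> ts" "ts < 1"
proof -
  show "0 \<le> ts"
    unfolding ts_def tstar_def by (rule cInf_greatest[OF ts_set_nonempty]) auto
  obtain t where t: "0 \<le> t" "t < 1" "deriv (beta_fun beta) t + ln (1 - t) < 0"
    using ts_set_nonempty by blast
  then have "ts \<le> t"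
    unfolding ts_def tstar_def by (intro cInf_lower bdd_belowI[of _ 0]) auto
  then show "ts < 1"
    using t by simp
qed

lemma neg_near_ts:
  assumes "e > 0"
  obtains t where "ts \<le> t" "t < ts + e" "t < 1" "dbeta t + ln (1 - t) < 0"
proof -
  let ?S = "{t. 0 \<le> t \<and> t < 1 \<and> deriv (beta_fun beta) t + ln (1 - t) < 0}"
  have bdd: "bdd_below ?S"
    by (intro bdd_belowI[of _ 0]) auto
  have "Inf ?S < ts + e"
    using assms by (simp add: ts_def tstar_def)
  then obtain t where t: "t \<in> ?S" "t < ts + e"
    using cInf_less_iff[OF ts_set_nonempty bdd] by blast
  moreover have "ts \<le> t"
    unfolding ts_def tstar_def using t bdd by (intro cInf_lower)
  ultimately show ?thesis
    using that[of t] by (auto simp: deriv_beta_fun)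
qed

lemma ge_0_below_ts:
  assumes "0 \<le> t" "t < ts"
  shows "dbeta t + ln (1 - t) \<ge> 0"
proof (rule ccontr)
  assume "\<not> ?thesis"
  then have "t \<in> {t. 0 \<le> t \<and> t < 1 \<and> deriv (beta_fun beta) t + ln (1 - t) < 0}"
    using assms ts_range by (auto simp: deriv_beta_fun)
  then have "ts \<le> t"
    unfolding ts_def tstar_def by (intro cInf_lower bdd_belowI[of _ 0]) auto
  then show False
    using assms by simp
qed

text \<open>By continuity: \<open>g\<close> is nonnegative to the left of \<open>ts\<close>, while
  points with negative value lie arbitrarily close at or above \<open>ts\<close>. For
  \<open>ts = 0\<close> the left side is empty, and \<open>g 0 = beta 1\<close> is used
  instead.\<close>

lemma dbeta_ts: "dbeta ts = - ln (1 - ts)"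
proof -
  define g where "g t = dbeta t + ln (1 - t)" for t
  have "isCont g ts"
    unfolding g_def using ts_range by (intro continuous_intros isCont_dbeta) auto
  then have cont: "g \<midarrow>ts\<rightarrow> g ts"
    by (simp add: isCont_def)
  have "g ts \<ge> 0"
  proof (cases "ts = 0")
    case True
    have "dbeta 0 = beta 1"
      using powser_zero[of "\<lambda>j. real (Suc j) * beta (Suc j)"] by (simp add: dbeta_def)
    then show ?thesis
      using True nonneg[of 1] by (simp add: g_def)
  next
    case False
    show ?thesis
    proof (rule tendsto_lowerbound)
      show "(g \<longlongrightarrow> g ts) (at_left ts)"
        using cont by (rule tendsto_within_subset) auto
      have "\<forall>\<^sub>F t in at_left ts. t \<in> {0<..<ts}"
        using False ts_range by (intro eventually_at_left_real) auto
      then show "\<forall>\<^sub>F t in at_left ts. 0 \<le> g t"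
        by eventually_elim (use ge_0_below_ts in \<open>auto simp: g_def\<close>)
    qed simp
  qed
  moreover have "g ts \<le> 0"
  proof (rule ccontr)
    assume pos: "\<not> g ts \<le> 0"
    then have "\<forall>\<^sub>F t in at ts. g t > 0"
      using order_tendstoD(1)[OF cont, of 0] by simp
    then obtain e where e: "e > 0" "\<And>t. t \<noteq> ts \<Longrightarrow> dist t ts < e \<Longrightarrow> g t > 0"
      by (auto simp: eventually_at)
    obtain t where t: "ts \<le> t" "t < ts + e" "g t < 0"
      using neg_near_ts[OF e(1)] by (auto simp: g_def)
    then show False
      using e(2)[of t] pos by (cases "t = ts") (auto simp: dist_real_def)
  qed
  ultimately show ?thesis
    by (simp add: g_def)
qed

end

section \<open>Convergence of the density of identifiable vertices\<close>

locale hypergraph_limit = hypergraph_params +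
  assumes nozero: "\<And>t. 0 \<le> t \<Longrightarrow> t < tstar beta \<Longrightarrow> deriv (beta_fun beta) t + ln (1 - t) \<noteq> 0"
begin

text \<open>Excluding zeros makes the inequality strict, which gives the bootstrap its positive
  minimum on compact subintervals.\<close>

lemma pos_below_ts:
  assumes "0 \<le> t" "t < ts"
  shows "dbeta t + ln (1 - t) > 0"
  using nozero[of t] ge_0_below_ts[OF assms] assms ts_range
  by (auto simp: deriv_beta_fun ts_def[symmetric])

theorem card_patch_closure_concentrated:
  "conv_in_prob (poisson_hypergraph beta) (\<lambda>N L. real (card (patch_closure N L)) / real N) ts"
  unfolding conv_in_prob_def
proof (intro allI impI)
  fix e :: real assume e: "e > 0"
  obtain t where t: "ts \<le> t" "t < ts + e" "t < 1" "dbeta t + ln (1 - t) < 0"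
    using neg_near_ts[OF e] .
  \<comment> \<open>Truncation at 0 keeps \<open>s\<close> in the range of
    \<open>level_final_lower\<close>. If \<open>ts = 0\<close> then \<open>s = 0\<close> and the
    lower deviation event is empty.\<close>
  define s where "s = max 0 (ts - e)"
  have low: "(\<lambda>N. measure_pmf.prob (level_pmf N) {L. real (card (level_final N L)) < s * real N}) \<longlonglongrightarrow> 0"
  proof (cases "ts = 0")
    case True
    then have "s = 0"
      using e by (simp add: s_def)
    then show ?thesis
      by simp
  next
    case False
    then have "s < ts"
      using e ts_range by (auto simp: s_def)
    then show ?thesis
      using ts_range pos_below_ts by (intro level_final_lower) (auto simp: s_def)
  qed
  have up: "(\<lambda>N. measure_pmf.prob (level_pmf N) {L. real (card (level_final N L)) > t * real N}) \<longlonglongrightarrow> 0"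
    using t ts_range by (intro level_final_upper) auto
  show "(\<lambda>N. measure_pmf.prob (poisson_hypergraph beta N)
      {L. \<bar>real (card (patch_closure N L)) / real N - ts\<bar> > e}) \<longlonglongrightarrow> 0"
  proof (rule tendsto_sandwich[OF _ _ tendsto_const tendsto_add_zero[OF low up]])
    show "\<forall>\<^sub>F N in sequentially.
      measure_pmf.prob (poisson_hypergraph beta N) {L. \<bar>real (card (patch_closure N L)) / real N - ts\<bar> > e} \<le>
      measure_pmf.prob (level_pmf N) {L. real (card (level_final N L)) < s * real N} +
      measure_pmf.prob (level_pmf N) {L. real (card (level_final N L)) > t * real N}"
      using eventually_gt_at_top[of 0]
    proof eventually_elim
      case (elim N)
      have "real c < s * real N \<or> real c > t * real N" if "\<bar>real c / real N - ts\<bar> > e" for c :: nat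
      proof -
        have "real c / real N < ts - e \<or> real c / real N > ts + e"
          using that by linarith
        then have "real c / real N < s \<or> real c / real N > t"
          using t by (auto simp: s_def)
        then show ?thesis
          using elim by (simp add: field_simps)
      qed
      then show ?case
        unfolding prob_patch_closure[of N "\<lambda>S. \<bar>real (card S) / real N - ts\<bar> > e"]
        by (intro order_trans[OF measure_pmf.finite_measure_mono
          measure_Un_le]) auto
    qed
  qed simp
qed

end

section \<open>Essential edges\<close>

lemma patch_closure_subset: "patch_closure N L \<subseteq> {..<N}"
  unfolding patch_closure_def by (rule firing_rule.fire_closure_subset[OF firing_rule_edge])

lemma finite_patch_closure: "finite (patch_closure N L)"
  using patch_closure_subset by (rule finite_subset) simp

lemma patch_closure_closed:
  "A \<subseteq> {..<N} \<Longrightarrow> L A > 0 \<Longrightarrow> card (A - patch_closure N L) \<noteq> 1"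
  using firing_rule.fire_closed_fire_closure[OF firing_rule_edge[of N], of "{..<N}" "active (edge_sets N) L"]
  unfolding patch_closure_def[symmetric] fire_closed_edge_iff card_1_singleton_iff One_nat_def by auto

lemma patch_closure_least:
  assumes "S \<subseteq> {..<N}" "\<And>A. A \<subseteq> {..<N} \<Longrightarrow> L A > 0 \<Longrightarrow> card (A - S) \<noteq> 1"
  shows "patch_closure N L \<subseteq> S"
proof -
  have "A - S \<noteq> {v}" if "A \<subseteq> {..<N}" "L A > 0" for A v
  proof
    assume "A - S = {v}"
    then have "card (A - S) = 1"
      by simp
    then show False
      using assms(2) that by blast
  qed
  then show ?thesis
    unfolding patch_closure_def using assms(1)
    by (intro firing_rule.fire_closure_least[OF firing_rule_edge]) (auto simp: fire_closed_edge_iff)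
qed

lemma patch_closure_mono:
  assumes "\<And>A. L A > 0 \<Longrightarrow> L' A > 0"
  shows "patch_closure N L \<subseteq> patch_closure N L'"
  by (rule patch_closure_least[OF patch_closure_subset]) (use assms patch_closure_closed in blast)

lemma patch_closure_cong:
  assumes "\<And>A. L A > 0 \<longleftrightarrow> L' A > 0"
  shows "patch_closure N L = patch_closure N L'"
  by (intro subset_antisym patch_closure_mono) (use assms in auto)

text \<open>If \<open>A\<close> does not miss the old closure in exactly one vertex, that closure
  stays closed after adding \<open>A\<close>. Otherwise it violates closedness, so the closure has
  to grow.\<close>

lemma patch_closure_add_edge:
  assumes "A \<subseteq> {..<N}"
  shows "patch_closure N (L(A := 0)) \<subset> patch_closure N (L(A := 1)) \<longleftrightarrow>
    card (A - patch_closure N (L(A := 0))) = 1"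
proof -
  define S0 S1 where "S0 = patch_closure N (L(A := 0))" and "S1 = patch_closure N (L(A := 1))"
  have sub: "S0 \<subseteq> S1"
    unfolding S0_def S1_def by (rule patch_closure_mono) (auto split: if_splits)
  have "S1 \<subseteq> S0" if "card (A - S0) \<noteq> 1"
    unfolding S1_def
  proof (rule patch_closure_least)
    show "S0 \<subseteq> {..<N}"
      unfolding S0_def by (rule patch_closure_subset)
    show "card (B - S0) \<noteq> 1" if "B \<subseteq> {..<N}" "(L(A := 1)) B > 0" for B
      using that \<open>card (A - S0) \<noteq> 1\<close> patch_closure_closed[of B N "L(A := 0)"]
      by (cases "B = A") (auto simp: S0_def)
  qed
  moreover have "S1 \<noteq> S0" if "card (A - S0) = 1"
    using that patch_closure_closed[OF assms, of "L(A := 1)"] by (auto simp: S1_def)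
  ultimately have "S0 \<subset> S1 \<longleftrightarrow> card (A - S0) = 1"
    using sub by blast
  then show ?thesis
    by (simp only: S0_def S1_def)
qed

definition ess_edge :: "nat \<Rightarrow> nat set \<Rightarrow> (nat set \<Rightarrow> nat) \<Rightarrow> bool" where
  "ess_edge N A L \<longleftrightarrow> L A = 1 \<and> card (A - patch_closure N (L(A := 0))) = 1"

definition k_sets :: "nat \<Rightarrow> nat \<Rightarrow> nat set set" where
  "k_sets N k = {A. A \<subseteq> {..<N} \<and> card A = k}"

lemma finite_k_sets: "finite (k_sets N k)"
  by (simp add: k_sets_def)

lemma card_k_sets: "card (k_sets N k) = N choose k"
  by (simp add: k_sets_def n_subsets)

lemma k_sets_edge_sets: "k \<ge> 1 \<Longrightarrow> A \<in> k_sets N k \<Longrightarrow> A \<in> edge_sets N"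
  by (auto simp: k_sets_def edge_sets_def)

text \<open>With two or more copies, deleting one leaves the set of present edges unchanged. With a
  single copy, a smaller closure size is the same as a strict inclusion, by monotonicity and
  finiteness.\<close>

lemma essential_iff:
  assumes "A \<subseteq> {..<N}"
  shows "(if card (identifiable N (L(A := L A - 1))) < card (identifiable N L) then L A else 0) =
    of_bool (ess_edge N A L)"
proof -
  consider "L A = 0" | "L A = 1" | "L A \<ge> 2"
    by linarith
  then show ?thesis
  proof cases
    case 1
    then show ?thesis
      by (simp add: ess_edge_def)
  next
    case 2
    then have L: "L(A := 1) = L"
      by auto
    have "card (patch_closure N (L(A := 0))) < card (patch_closure N L) \<longleftrightarrow>
        patch_closure N (L(A := 0)) \<subset> patch_closure N L"
    proof
      assume "card (patch_closure N (L(A := 0))) < card (patch_closure N L)"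
      moreover have "patch_closure N (L(A := 0)) \<subseteq> patch_closure N L"
        by (rule patch_closure_mono) (auto split: if_splits)
      ultimately show "patch_closure N (L(A := 0)) \<subset> patch_closure N L"
        by (intro psubsetI notI) auto
    qed (intro psubset_card_mono finite_patch_closure)
    then show ?thesis
      using 2 patch_closure_add_edge[OF assms, of L] unfolding L
      by (simp add: identifiable_eq_patch_closure ess_edge_def)
  next
    case 3
    then have "patch_closure N (L(A := L A - 1)) = patch_closure N L"
      by (intro patch_closure_cong) auto
    then show ?thesis
      using 3 by (simp add: identifiable_eq_patch_closure ess_edge_def)
  qed
qed

lemma essential_count_eq:
  "real (essential_count N k L) = (\<Sum>A\<in>k_sets N k. of_bool (ess_edge N A L))"
  unfolding essential_count_def k_sets_def of_nat_sum
  by (intro sum.cong refl) (subst essential_iff, auto)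

text \<open>Such a \<open>k\<close>-set consists of one vertex outside \<open>S\<close> and
  \<open>k - 1\<close> vertices of \<open>S\<close>. The count is \<open>sum_firing_edges\<close>
  with the indicator of size \<open>k\<close> as weight.\<close>

lemma sum_one_missing:
  assumes "k \<ge> 1" "S \<subseteq> {..<N}"
  shows "(\<Sum>A\<in>k_sets N k. of_bool (card (A - S) = 1)) = real (N - card S) * real (card S choose (k - 1))"
proof -
  have eq: "(\<exists>v\<in>{..<N} - S. edge_fires A S v) \<longleftrightarrow> card (A - S) = 1" if "A \<in> edge_sets N" for A
  proof
    assume "card (A - S) = 1"
    then obtain v where v: "A - S = {v}"
      by (auto simp: card_1_singleton_iff)
    then have "v \<in> {..<N} - S"
      using that by (auto simp: edge_sets_def)
    then show "\<exists>v\<in>{..<N} - S. edge_fires A S v"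
      using v by (auto simp: edge_fires_def)
  qed (auto simp: edge_fires_def)
  have "(\<Sum>A\<in>k_sets N k. of_bool (card (A - S) = 1)) =
      (\<Sum>A | A \<in> edge_sets N \<and> card (A - S) = 1. of_bool (card A = k) :: real)"
    by (rule sum.mono_neutral_cong)
       (use assms(1) finite_edge_sets[of N] in \<open>auto simp: k_sets_def edge_sets_def\<close>)
  also have "\<dots> = (\<Sum>A | A \<in> edge_sets N \<and> (\<exists>v\<in>{..<N} - S. edge_fires A S v). of_bool (card A = k))"
    using eq by (intro sum.cong refl Collect_cong conj_cong) auto
  also have "\<dots> = real (N - card S) * (\<Sum>j\<le>card S. real (card S choose j) * of_bool (Suc j = k))"
    using sum_firing_edges[OF assms(2) subset_refl, of "\<lambda>n. of_bool (n = k)"] by simp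
  also have "(\<Sum>j\<le>card S. real (card S choose j) * of_bool (Suc j = k)) =
      (\<Sum>j\<le>card S. if j = k - 1 then real (card S choose (k - 1)) else 0)"
    using assms(1) by (intro sum.cong) auto
  also have "\<dots> = real (card S choose (k - 1))"
    by (simp add: binomial_eq_0)
  finally show ?thesis .
qed

text \<open>Double counting: a vertex lies in \<open>N - 1 choose (k - 1)\<close> of the
  \<open>k\<close>-sets. This number comes from \<open>sum_one_missing\<close>, taking all vertices
  except \<open>v\<close> as \<open>S\<close>.\<close>

lemma sum_k_sets_containing:
  assumes "k \<ge> 1"
  shows "(\<Sum>B\<in>k_sets N k. \<Sum>v\<in>B. f v) = real (N - 1 choose (k - 1)) * (\<Sum>v<N. f v)"
proof -
  have "(\<Sum>B\<in>k_sets N k. \<Sum>v\<in>B. f v) = (\<Sum>B\<in>k_sets N k. \<Sum>v<N. of_bool (v \<in> B) * f v)"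
    by (intro sum.cong refl sum.mono_neutral_cong_left) (auto simp: k_sets_def)
  also have "\<dots> = (\<Sum>v<N. (\<Sum>B\<in>k_sets N k. of_bool (v \<in> B)) * f v)"
    by (subst sum.swap) (simp add: sum_distrib_right)
  also have "\<dots> = (\<Sum>v<N. real (N - 1 choose (k - 1)) * f v)"
  proof (intro sum.cong refl arg_cong2[where f = times])
    fix v assume v: "v \<in> {..<N}"
    have "(\<Sum>B\<in>k_sets N k. of_bool (v \<in> B) :: real) =
        (\<Sum>B\<in>k_sets N k. of_bool (card (B - ({..<N} - {v})) = 1))"
    proof (intro sum.cong refl)
      fix B assume "B \<in> k_sets N k"
      then have "B - ({..<N} - {v}) = (if v \<in> B then {v} else {})"
        by (auto simp: k_sets_def)
      then show "(of_bool (v \<in> B) :: real) = of_bool (card (B - ({..<N} - {v})) = 1)"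
        by simp
    qed
    also have "\<dots> = real (N - card ({..<N} - {v})) * real (card ({..<N} - {v}) choose (k - 1))"
      by (rule sum_one_missing[OF assms]) auto
    also have "card ({..<N} - {v}) = N - 1"
      using v by simp
    finally show "(\<Sum>B\<in>k_sets N k. of_bool (v \<in> B)) = real (N - 1 choose (k - 1))"
      using v by simp
  qed
  finally show ?thesis
    by (simp add: sum_distrib_left)
qed

section \<open>Moments of the number of essential edges\<close>

lemma integrable_of_bool: "integrable (measure_pmf p) (\<lambda>x. of_bool (Q x) :: real)"
  by (rule integrable_pmf_bounded[where B = 1]) auto

lemma expectation_count:
  "measure_pmf.expectation p (\<lambda>x. \<Sum>A\<in>K. of_bool (Q A x) :: real) = (\<Sum>A\<in>K. measure_pmf.prob p {x. Q A x})"
  by (simp add: Bochner_Integration.integral_sum integrable_of_bool expectation_of_bool)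

lemma expectation_count_square:
  "measure_pmf.expectation p (\<lambda>x. (\<Sum>A\<in>K. of_bool (Q A x) :: real)\<^sup>2) =
    (\<Sum>A\<in>K. \<Sum>B\<in>K. measure_pmf.prob p {x. Q A x \<and> Q B x})"
proof -
  have "(\<lambda>x. (\<Sum>A\<in>K. of_bool (Q A x) :: real)\<^sup>2) = (\<lambda>x. \<Sum>A\<in>K. \<Sum>B\<in>K. of_bool (Q A x \<and> Q B x))"
    by (simp add: power2_eq_square sum_product of_bool_conj)
  then show ?thesis
    by (simp only:) (simp add: Bochner_Integration.integral_sum integrable_of_bool expectation_of_bool del: of_bool_conj)
qed

lemma prob_Un_disjoint:
  assumes "\<And>x. P x \<Longrightarrow> Q x \<Longrightarrow> False"
  shows "measure_pmf.prob p {x. P x \<or> Q x} = measure_pmf.prob p {x. P x} + measure_pmf.prob p {x. Q x}"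
proof -
  have "{x. P x \<or> Q x} = {x. P x} \<union> {x. Q x}"
    by auto
  then show ?thesis
    by (simp only:) (rule measure_pmf.finite_measure_Union, use assms in auto)
qed

locale edge_moments = hypergraph_params +
  fixes N k :: nat
  assumes k1: "k \<ge> 1" and kN: "k \<le> N"
begin

abbreviation "P \<equiv> poisson_hypergraph beta N"
abbreviation "E \<equiv> measure_pmf.expectation P"
abbreviation "pr \<equiv> measure_pmf.prob P"
abbreviation "K \<equiv> k_sets N k"
abbreviation "rt \<equiv> edge_rate beta N k"
abbreviation "pc \<equiv> patch_closure N"

definition num_ess :: "(nat set \<Rightarrow> nat) \<Rightarrow> real" where
  "num_ess L = (\<Sum>A\<in>K. of_bool (ess_edge N A L))"

definition num_sites :: "(nat set \<Rightarrow> nat) \<Rightarrow> real" where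
  "num_sites L = (\<Sum>A\<in>K. of_bool (card (A - pc L) = 1))"

lemma rt_nonneg: "rt \<ge> 0"
  using k1 nonneg by (intro edge_rate_nonneg) auto

lemma card_K_rt: "real (card K) * rt = real N * beta k"
  using kN by (simp add: card_k_sets edge_rate_def)

text \<open>The expected number of \<open>k\<close>-edges through a given vertex.\<close>

lemma rt_binomial: "rt * real (N - 1 choose (k - 1)) = real k * beta k"
proof -
  have "real (N - 1 choose (k - 1)) \<noteq> 0"
    using k1 kN by simp
  then show ?thesis
    using edge_rate_Suc[of N "k - 1"] k1 kN by simp
qed

lemma add_edge:
  assumes "A \<in> K"
  shows "pr {L. L A = 1 \<and> Q (L(A := 0))} = rt * pr {L. L A = 0 \<and> Q L}"
  using pois_prod_add_point[OF finite_edge_sets k_sets_edge_sets[OF k1 assms],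
      of "\<lambda>A. edge_rate beta N (card A)" Q] rt_nonneg assms
  unfolding poisson_hypergraph_eq by (simp add: k_sets_def)

lemma K_subset: "A \<in> K \<Longrightarrow> A \<subseteq> {..<N}"
  by (simp add: k_sets_def)

lemma prob_ess_edge:
  assumes "A \<in> K"
  shows "pr {L. ess_edge N A L} = rt * pr {L. card (A - pc L) = 1}"
proof -
  \<comment> \<open>A present edge never misses the closure in exactly one vertex, so the right-hand
    condition already forces \<open>A\<close> to be absent.\<close>
  have "L A = 0 \<and> card (A - pc L) = 1 \<longleftrightarrow> card (A - pc L) = 1" for L
    using patch_closure_closed[OF K_subset[OF assms], of L] by auto
  then show ?thesis
    unfolding ess_edge_def add_edge[OF assms, of "\<lambda>L. card (A - pc L) = 1"] by simp
qed

lemma expectation_num_ess: "E num_ess = rt * E num_sites"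
  unfolding num_ess_def num_sites_def expectation_count by (simp add: prob_ess_edge sum_distrib_left)

lemma num_ess_bounds: "0 \<le> num_ess L" "num_ess L \<le> real (card K)"
  using sum_bounded_above[of K "\<lambda>A. of_bool (ess_edge N A L)" "1 :: real"]
  by (auto simp: num_ess_def intro: sum_nonneg)

lemma num_sites_bounds: "0 \<le> num_sites L" "num_sites L \<le> real (card K)"
  using sum_bounded_above[of K "\<lambda>A. of_bool (card (A - pc L) = 1)" "1 :: real"]
  by (auto simp: num_sites_def intro: sum_nonneg)

lemma num_sites_eq: "num_sites L = real (N - card (pc L)) * real (card (pc L) choose (k - 1))"
  unfolding num_sites_def by (rule sum_one_missing[OF k1 patch_closure_subset])

text \<open>Adding a point to a Poisson variable shows that \<open>bal A\<close> is orthogonal to every function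
  that ignores the multiplicity of \<open>A\<close>.\<close>

definition bal :: "nat set \<Rightarrow> (nat set \<Rightarrow> nat) \<Rightarrow> real" where
  "bal A L = of_bool (L A = 1) - rt * of_bool (L A = 0)"

definition bal_sum :: "(nat set \<Rightarrow> nat) \<Rightarrow> real" where
  "bal_sum L = (\<Sum>A\<in>K. bal A L)"

lemma abs_bal_le: "\<bar>bal A L\<bar> \<le> 1 + rt"
  using rt_nonneg by (auto simp: bal_def)

lemma abs_bal_sum_le: "\<bar>bal_sum L\<bar> \<le> real (card K) * (1 + rt)"
  unfolding bal_sum_def using sum_bounded_above[of K "\<lambda>A. \<bar>bal A L\<bar>" "1 + rt"] abs_bal_le
  by (intro order_trans[OF sum_abs]) auto

lemma expectation_bal_of_bool:
  "E (\<lambda>L. bal A L * of_bool (Q L)) = pr {L. L A = 1 \<and> Q L} - rt * pr {L. L A = 0 \<and> Q L}"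
proof -
  have "(\<lambda>L. bal A L * of_bool (Q L)) = (\<lambda>L. of_bool (L A = 1 \<and> Q L) - rt * of_bool (L A = 0 \<and> Q L))"
    by (auto simp: bal_def fun_eq_iff)
  then show ?thesis
    by (simp only:) (simp add: integrable_of_bool expectation_of_bool del: of_bool_conj)
qed

lemma integrable_bal_of_bool: "integrable P (\<lambda>L. bal A L * of_bool (Q L))"
  by (rule integrable_pmf_bounded[where B = "1 + rt"]) (use abs_bal_le rt_nonneg in \<open>auto simp: abs_mult\<close>)

text \<open>Distinct \<open>A\<close> and \<open>B\<close> are orthogonal. On the diagonal the
  second moment is \<open>rt * (1 + rt) * exp (- rt)\<close>, and
  \<open>1 + rt \<le> exp rt\<close>.\<close>

lemma expectation_bal_bal:
  assumes "A \<in> K" "B \<in> K"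
  shows "E (\<lambda>L. bal A L * bal B L) \<le> (if A = B then rt else 0)"
proof (cases "A = B")
  case False
  have zero: "E (\<lambda>L. bal A L * of_bool (L B = n)) = 0" for n
    using add_edge[OF assms(1), of "\<lambda>L. L B = n"] False by (simp add: expectation_bal_of_bool)
  have "(\<lambda>L. bal A L * bal B L) = (\<lambda>L. bal A L * of_bool (L B = 1) - rt * (bal A L * of_bool (L B = 0)))"
    by (auto simp: bal_def[of B] algebra_simps)
  then have "E (\<lambda>L. bal A L * bal B L) = 0"
    by (simp only:) (simp add: integrable_bal_of_bool zero del: One_nat_def)
  then show ?thesis
    using False by simp
next
  case True
  have comp: "pr {L. L A = n} = pmf (pois rt) n" for n
    using prob_Pi_pmf_component[OF finite_edge_sets k_sets_edge_sets[OF k1 assms(1)],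
        of 0 "\<lambda>A. pois (edge_rate beta N (card A))" n] assms(1)
    by (simp add: poisson_hypergraph_eq pois_prod_def k_sets_def)
  have "(\<lambda>L. bal A L * bal B L) = (\<lambda>L. of_bool (L A = 1) + rt\<^sup>2 * of_bool (L A = 0))"
    using True by (auto simp: bal_def power2_eq_square)
  then have "E (\<lambda>L. bal A L * bal B L) = pr {L. L A = 1} + rt\<^sup>2 * pr {L. L A = 0}"
    by (simp only:) (simp add: integrable_of_bool expectation_of_bool)
  also have "\<dots> = rt * ((1 + rt) * exp (- rt))"
    using rt_nonneg by (simp only: comp pmf_pois_0 pmf_pois_1) (simp add: algebra_simps power2_eq_square)
  also have "\<dots> \<le> rt * (exp rt * exp (- rt))"
    using rt_nonneg exp_ge_add_one_self[of rt] by (intro mult_left_mono mult_right_mono) auto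
  also have "\<dots> = rt"
    by (simp add: exp_minus)
  finally show ?thesis
    using True by simp
qed

lemma expectation_bal_sum_square: "E (\<lambda>L. (bal_sum L)\<^sup>2) \<le> real N * beta k"
proof -
  have int: "integrable P (\<lambda>L. bal A L * bal B L)" for A B
  proof (rule integrable_pmf_bounded[where B = "(1 + rt) * (1 + rt)"])
    show "\<bar>bal A L * bal B L\<bar> \<le> (1 + rt) * (1 + rt)" for L
      unfolding abs_mult using abs_bal_le rt_nonneg by (intro mult_mono) auto
  qed
  have "E (\<lambda>L. (bal_sum L)\<^sup>2) = (\<Sum>A\<in>K. \<Sum>B\<in>K. E (\<lambda>L. bal A L * bal B L))"
    unfolding bal_sum_def power2_eq_square sum_product by (simp add: int Bochner_Integration.integral_sum)
  also have "\<dots> \<le> (\<Sum>A\<in>K. \<Sum>B\<in>K. if A = B then rt else 0)"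
    by (intro sum_mono expectation_bal_bal)
  also have "\<dots> = real (card K) * rt"
    by (simp add: finite_k_sets)
  finally show ?thesis
    by (simp add: card_K_rt)
qed

text \<open>The inequality \<open>x * b \<le> x^2 / (2 * a) + a / 2\<close> for an indicator value
  \<open>b\<close>, with \<open>a = sqrt (real N)\<close>, brings both terms to order
  \<open>sqrt (real N)\<close>, as the second moment of \<open>bal_sum\<close> is at most
  \<open>real N * beta k\<close>.\<close>

lemma expectation_bal_sum_of_bool:
  "E (\<lambda>L. bal_sum L * of_bool (Q L)) \<le> sqrt (real N) * (beta k + 1) / 2"
proof -
  define a where "a = sqrt (real N)"
  have N: "N \<ge> 1"
    using k1 kN by simp
  have a: "a > 0" "a * a = real N"
    using N by (auto simp: a_def)
  have int: "integrable P (\<lambda>L. (bal_sum L)\<^sup>2)"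
  proof (rule integrable_pmf_bounded)
    show "\<bar>(bal_sum L)\<^sup>2\<bar> \<le> (real (card K) * (1 + rt))\<^sup>2" for L
      using power_mono[OF abs_bal_sum_le[of L], of 2] by simp
  qed
  have int': "integrable P (\<lambda>L. bal_sum L * of_bool (Q L))"
    by (rule integrable_pmf_bounded[where B = "real (card K) * (1 + rt)"])
       (use abs_bal_sum_le rt_nonneg in \<open>auto simp: abs_mult\<close>)
  have amgm: "x * b \<le> (1 / (2 * a)) * x\<^sup>2 + a / 2" if "b \<in> {0, 1}" for x b :: real
  proof -
    have "0 \<le> (x - a)\<^sup>2 / (2 * a)"
      using a by simp
    also have "\<dots> = (1 / (2 * a)) * x\<^sup>2 + a / 2 - x"
      using a by (simp add: power2_eq_square field_simps)
    finally have "x \<le> (1 / (2 * a)) * x\<^sup>2 + a / 2"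
      by simp
    moreover have "0 \<le> (1 / (2 * a)) * x\<^sup>2 + a / 2"
      using a by simp
    ultimately show ?thesis
      using that by auto
  qed
  have "E (\<lambda>L. bal_sum L * of_bool (Q L)) \<le> E (\<lambda>L. (1 / (2 * a)) * (bal_sum L)\<^sup>2 + a / 2)"
  proof (rule integral_mono[OF int'])
    show "bal_sum L * of_bool (Q L) \<le> (1 / (2 * a)) * (bal_sum L)\<^sup>2 + a / 2" for L
      by (rule amgm) auto
  qed (use int in simp)
  also have "\<dots> = (1 / (2 * a)) * E (\<lambda>L. (bal_sum L)\<^sup>2) + a / 2"
    using int by simp
  also have "\<dots> \<le> (1 / (2 * a)) * (a * a * beta k) + a / 2"
    using expectation_bal_sum_square a by (intro add_right_mono mult_left_mono) auto
  also have "\<dots> = a * (beta k + 1) / 2"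
    using a(1) by (simp add: field_simps)
  finally show ?thesis
    by (simp add: a_def)
qed

section \<open>Interaction of two added edges\<close>

definition gain_prob :: "nat set \<Rightarrow> nat \<Rightarrow> real" where
  "gain_prob A v = pr {L. L A = 0 \<and> v \<in> pc (L(A := 1)) - pc L}"

text \<open>Adding the point \<open>A\<close> turns \<open>rt\<close> times the probability that
  \<open>v\<close> is identified after insertion into the probability that \<open>A\<close> is
  simple and \<open>v\<close> identified. Subtracting the part where \<open>v\<close> was identified
  before leaves the correlation with \<open>bal A\<close>.\<close>

lemma gain_prob_eq:
  assumes "A \<in> K"
  shows "rt * gain_prob A v = E (\<lambda>L. bal A L * of_bool (v \<in> pc L))"
proof -
  have mono: "pc L \<subseteq> pc (L(A := 1))" for L
    by (rule patch_closure_mono) auto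
  have "{L. L A = 0 \<and> v \<in> pc (L(A := 1))} =
      {L. (L A = 0 \<and> v \<in> pc (L(A := 1)) - pc L) \<or> (L A = 0 \<and> v \<in> pc L)}"
    using mono by blast
  then have "pr {L. L A = 0 \<and> v \<in> pc (L(A := 1))} = gain_prob A v + pr {L. L A = 0 \<and> v \<in> pc L}"
    unfolding gain_prob_def by (simp only:) (rule prob_Un_disjoint, auto)
  moreover have "rt * pr {L. L A = 0 \<and> v \<in> pc (L(A := 1))} = pr {L. L A = 1 \<and> v \<in> pc L}"
  proof -
    have "{L. L A = 1 \<and> v \<in> pc L} = {L. L A = 1 \<and> v \<in> pc ((L(A := 0))(A := 1))}"
      by (intro Collect_cong conj_cong refl arg_cong[where f = "\<lambda>L. v \<in> pc L"]) auto
    then show ?thesis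
      using add_edge[OF assms, of "\<lambda>L. v \<in> pc (L(A := 1))"] by (simp only:)
  qed
  ultimately show ?thesis
    unfolding expectation_bal_of_bool by (simp add: algebra_simps)
qed

text \<open>Bounding each probability by 1 would only give \<open>real N * beta k\<close>. Summed
  over \<open>A\<close>, the correlations combine into one with \<open>bal_sum\<close>, which is of
  order \<open>sqrt (real N)\<close>.\<close>

lemma sum_gain_prob_le: "rt * (\<Sum>A\<in>K. gain_prob A v) \<le> sqrt (real N) * (beta k + 1) / 2"
proof -
  have "rt * (\<Sum>A\<in>K. gain_prob A v) = (\<Sum>A\<in>K. E (\<lambda>L. bal A L * of_bool (v \<in> pc L)))"
    by (simp add: sum_distrib_left gain_prob_eq)
  also have "\<dots> = E (\<lambda>L. bal_sum L * of_bool (v \<in> pc L))"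
    unfolding bal_sum_def sum_distrib_right
    by (subst Bochner_Integration.integral_sum) (auto intro: integrable_bal_of_bool)
  also have "\<dots> \<le> sqrt (real N) * (beta k + 1) / 2"
    by (rule expectation_bal_sum_of_bool)
  finally show ?thesis .
qed

text \<open>The one-point formula is applied first to \<open>A\<close> and then to
  \<open>B\<close>.\<close>

lemma prob_ess_pair_eq:
  assumes A: "A \<in> K" and B: "B \<in> K" and AB: "A \<noteq> B"
  shows "pr {L. ess_edge N A L \<and> ess_edge N B L} =
    rt * (rt * pr {L. L B = 0 \<and> L A = 0 \<and> card (A - pc (L(B := 1))) = 1 \<and> card (B - pc (L(A := 1))) = 1})"
proof -
  \<comment> \<open>\<open>Q1\<close> is evaluated with \<open>A\<close> removed, so the condition
    on \<open>B\<close> has to put \<open>A\<close> back. \<open>Q2\<close> likewise restores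
    \<open>B\<close> in the condition on \<open>A\<close>.\<close>
  define Q1 where "Q1 L \<longleftrightarrow> L B = 1 \<and> card (A - pc L) = 1 \<and> card (B - pc (L(A := 1, B := 0))) = 1"
    for L :: "nat set \<Rightarrow> nat"
  define Q2 where "Q2 L \<longleftrightarrow> L A = 0 \<and> card (A - pc (L(B := 1))) = 1 \<and> card (B - pc (L(A := 1))) = 1"
    for L :: "nat set \<Rightarrow> nat"
  have "{L. ess_edge N A L \<and> ess_edge N B L} = {L. L A = 1 \<and> Q1 (L(A := 0))}"
  proof (intro Collect_cong)
    fix L :: "nat set \<Rightarrow> nat"
    have "(L(A := 0))(A := 1, B := 0) = L(B := 0)" if "L A = 1"
      using that AB by auto
    then show "ess_edge N A L \<and> ess_edge N B L \<longleftrightarrow> L A = 1 \<and> Q1 (L(A := 0))"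
      using AB by (auto simp: ess_edge_def Q1_def)
  qed
  then have "pr {L. ess_edge N A L \<and> ess_edge N B L} = rt * pr {L. L A = 0 \<and> Q1 L}"
    by (simp only: add_edge[OF A])
  also have "{L. L A = 0 \<and> Q1 L} = {L. L B = 1 \<and> Q2 (L(B := 0))}"
  proof (intro Collect_cong)
    fix L :: "nat set \<Rightarrow> nat"
    have 1: "(L(B := 0))(B := 1) = L" if "L B = 1"
      using that by auto
    have 2: "(L(B := 0))(A := 1) = L(A := 1, B := 0)"
      using AB by auto
    show "L A = 0 \<and> Q1 L \<longleftrightarrow> L B = 1 \<and> Q2 (L(B := 0))"
      unfolding Q1_def Q2_def 2 using AB 1 by (auto simp del: One_nat_def)
  qed
  also have "pr \<dots> = rt * pr {L. L B = 0 \<and> Q2 L}"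
    by (rule add_edge[OF B])
  finally show ?thesis
    by (simp only: Q2_def)
qed

text \<open>If neither inserted edge newly identifies a vertex of the other, both differences are
  the same as without insertion. The exceptional event is covered by a union bound over
  vertices.\<close>

lemma prob_ess_pair_le:
  assumes A: "A \<in> K" and B: "B \<in> K" and AB: "A \<noteq> B"
  shows "pr {L. ess_edge N A L \<and> ess_edge N B L} \<le> rt\<^sup>2 *
    (pr {L. card (A - pc L) = 1 \<and> card (B - pc L) = 1} + (\<Sum>v\<in>B. gain_prob A v) + (\<Sum>v\<in>A. gain_prob B v))"
proof -
  have fin: "finite A" "finite B"
    using A B by (auto intro: finite_subset[OF K_subset finite_lessThan])
  let ?new = "\<lambda>A v. {L. L A = 0 \<and> v \<in> pc (L(A := 1)) - pc L}"
  have same: "C - pc (L(F := 1)) = C - pc L" if "L F = 0" "\<And>v. v \<in> C \<Longrightarrow> L \<notin> ?new F v" for L C F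
  proof -
    have "pc L \<subseteq> pc (L(F := 1))"
      by (rule patch_closure_mono) auto
    then show ?thesis
      using that by auto
  qed
  have "{L. L B = 0 \<and> L A = 0 \<and> card (A - pc (L(B := 1))) = 1 \<and> card (B - pc (L(A := 1))) = 1} \<subseteq>
      {L. card (A - pc L) = 1 \<and> card (B - pc L) = 1} \<union> (\<Union>v\<in>B. ?new A v) \<union> (\<Union>v\<in>A. ?new B v)"
  proof
    fix L assume "L \<in> {L. L B = 0 \<and> L A = 0 \<and> card (A - pc (L(B := 1))) = 1 \<and> card (B - pc (L(A := 1))) = 1}"
    then have L: "L B = 0" "L A = 0" "card (A - pc (L(B := 1))) = 1" "card (B - pc (L(A := 1))) = 1"
      by auto
    show "L \<in> {L. card (A - pc L) = 1 \<and> card (B - pc L) = 1} \<union> (\<Union>v\<in>B. ?new A v) \<union> (\<Union>v\<in>A. ?new B v)"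
    proof (rule ccontr)
      assume *: "\<not> ?thesis"
      have "A - pc (L(B := 1)) = A - pc L" "B - pc (L(A := 1)) = B - pc L"
        using * by (intro same L(1,2); blast)+
      then show False
        using * L(3,4) by simp
    qed
  qed
  then have "pr {L. L B = 0 \<and> L A = 0 \<and> card (A - pc (L(B := 1))) = 1 \<and> card (B - pc (L(A := 1))) = 1} \<le>
      pr ({L. card (A - pc L) = 1 \<and> card (B - pc L) = 1} \<union> (\<Union>v\<in>B. ?new A v) \<union> (\<Union>v\<in>A. ?new B v))"
    by (intro measure_pmf.finite_measure_mono) auto
  also have "\<dots> \<le> pr ({L. card (A - pc L) = 1 \<and> card (B - pc L) = 1}) + pr (\<Union>v\<in>B. ?new A v) + pr (\<Union>v\<in>A. ?new B v)"
    by (intro order_trans[OF measure_Un_le] add_mono order_refl measure_Un_le) auto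
  also have "\<dots> \<le> pr ({L. card (A - pc L) = 1 \<and> card (B - pc L) = 1}) + (\<Sum>v\<in>B. gain_prob A v) + (\<Sum>v\<in>A. gain_prob B v)"
    unfolding gain_prob_def by (intro add_mono order_refl measure_pmf.finite_measure_subadditive_finite fin) auto
  finally show ?thesis
    unfolding prob_ess_pair_eq[OF assms] power2_eq_square mult.assoc
    using rt_nonneg by (intro mult_left_mono) auto
qed

text \<open>Summing over the sets \<open>B\<close> through \<open>v\<close> uses one factor
  \<open>rt\<close> and gives \<open>real k * beta k\<close>. The other factor goes into
  \<open>sum_gain_prob_le\<close>, once for each of the \<open>N\<close> vertices.\<close>

lemma sum_gain_prob_pairs: "rt\<^sup>2 * (\<Sum>A\<in>K. \<Sum>B\<in>K. \<Sum>v\<in>B. gain_prob A v) \<le>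
    real k * beta k * (real N * (sqrt (real N) * (beta k + 1) / 2))"
proof -
  have "rt\<^sup>2 * (\<Sum>A\<in>K. \<Sum>B\<in>K. \<Sum>v\<in>B. gain_prob A v) =
      rt\<^sup>2 * (real (N - 1 choose (k - 1)) * (\<Sum>A\<in>K. \<Sum>v<N. gain_prob A v))"
    by (simp add: sum_k_sets_containing[OF k1] sum_distrib_left)
  also have "\<dots> = (rt * real (N - 1 choose (k - 1))) * (\<Sum>v<N. rt * (\<Sum>A\<in>K. gain_prob A v))"
    unfolding sum.swap[of gain_prob "{..<N}" K] sum_distrib_left[symmetric] by (simp add: power2_eq_square)
  also have "\<dots> = real k * beta k * (\<Sum>v<N. rt * (\<Sum>A\<in>K. gain_prob A v))"
    by (simp only: rt_binomial)
  also have "\<dots> \<le> real k * beta k * (\<Sum>v<N. sqrt (real N) * (beta k + 1) / 2)"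
    using nonneg[OF k1] by (intro mult_left_mono sum_mono sum_gain_prob_le) auto
  finally show ?thesis
    by simp
qed

lemma expectation_num_ess_square:
  "E (\<lambda>L. (num_ess L)\<^sup>2) \<le> E num_ess + E (\<lambda>L. (rt * num_sites L)\<^sup>2) + real k * beta k * (beta k + 1) * (real N * sqrt (real N))"
proof -
  define T where "T A B = pr {L. card (A - pc L) = 1 \<and> card (B - pc L) = 1}" for A B
  define U where "U A B = (\<Sum>v\<in>B. gain_prob A v)" for A B
  have nn: "T A B \<ge> 0" "U A B \<ge> 0" for A B
    by (auto simp: T_def U_def gain_prob_def intro: sum_nonneg)
  have "E (\<lambda>L. (num_ess L)\<^sup>2) = (\<Sum>A\<in>K. \<Sum>B\<in>K. pr {L. ess_edge N A L \<and> ess_edge N B L})"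
    unfolding num_ess_def by (rule expectation_count_square)
  \<comment> \<open>The nonnegative pair terms are added on the diagonal too, so that the terms
    \<open>T A B\<close> sum to the full second moment of \<open>num_sites\<close>.\<close>
  also have "\<dots> \<le> (\<Sum>A\<in>K. \<Sum>B\<in>K. (if A = B then pr {L. ess_edge N A L} else 0) + rt\<^sup>2 * (T A B + U A B + U B A))"
  proof (intro sum_mono)
    fix A B assume "A \<in> K" "B \<in> K"
    then show "pr {L. ess_edge N A L \<and> ess_edge N B L} \<le>
        (if A = B then pr {L. ess_edge N A L} else 0) + rt\<^sup>2 * (T A B + U A B + U B A)"
      using nn[of A B] nn[of B A] prob_ess_pair_le[of A B]
      by (cases "A = B") (auto simp: T_def U_def)
  qed
  also have "\<dots> = (\<Sum>A\<in>K. pr {L. ess_edge N A L}) + rt\<^sup>2 * (\<Sum>A\<in>K. \<Sum>B\<in>K. T A B) +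
      2 * (rt\<^sup>2 * (\<Sum>A\<in>K. \<Sum>B\<in>K. U A B))"
  proof -
    have "(\<Sum>A\<in>K. \<Sum>B\<in>K. U B A) = (\<Sum>A\<in>K. \<Sum>B\<in>K. U A B)"
      by (rule sum.swap)
    then show ?thesis
      by (simp add: sum.distrib finite_k_sets sum_distrib_left[symmetric] distrib_left)
  qed
  also have "(\<Sum>A\<in>K. pr {L. ess_edge N A L}) = E num_ess"
    unfolding num_ess_def by (rule expectation_count[symmetric])
  also have "rt\<^sup>2 * (\<Sum>A\<in>K. \<Sum>B\<in>K. T A B) = E (\<lambda>L. (rt * num_sites L)\<^sup>2)"
    unfolding num_sites_def T_def power_mult_distrib expectation_count_square[symmetric] by simp
  also have "2 * (rt\<^sup>2 * (\<Sum>A\<in>K. \<Sum>B\<in>K. U A B)) \<le>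
      real k * beta k * (beta k + 1) * (real N * sqrt (real N))"
    using sum_gain_prob_pairs unfolding U_def by (simp add: algebra_simps)
  finally show ?thesis
    by simp
qed

lemma expectation_num_ess_le: "E num_ess \<le> real N * beta k"
proof -
  have "E num_sites \<le> E (\<lambda>_. real (card K))"
    by (rule integral_mono) (use num_sites_bounds in \<open>auto intro!: integrable_pmf_bounded[where B = "real (card K)"]\<close>)
  then have "rt * E num_sites \<le> rt * real (card K)"
    using rt_nonneg by (intro mult_left_mono) auto
  then show ?thesis
    using card_K_rt by (simp add: expectation_num_ess mult.commute)
qed

text \<open>\<open>num_ess\<close> and \<open>rt * num_sites\<close> have the same mean, so
  expanding the squares around a common \<open>c\<close> leaves only the second moments to compare.
  Their difference is of order \<open>N * sqrt N\<close>, hence negligible after division by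
  \<open>N^2\<close>.\<close>

lemma expectation_num_ess_deviation:
  "E (\<lambda>L. (num_ess L / real N - c)\<^sup>2) \<le> E (\<lambda>L. (rt * num_sites L / real N - c)\<^sup>2) +
    beta k / real N + real k * beta k * (beta k + 1) / sqrt (real N)"
proof -
  have N: "real N > 0"
    using k1 kN by simp
  have intX: "integrable P num_ess" and intM: "integrable P num_sites"
    using num_ess_bounds num_sites_bounds by (auto intro!: integrable_pmf_bounded[where B = "real (card K)"])
  have intX2: "integrable P (\<lambda>L. (num_ess L)\<^sup>2)"
    using num_ess_bounds by (intro integrable_pmf_bounded[where B = "(real (card K))\<^sup>2"]) (simp add: power_mono)
  have intM2: "integrable P (\<lambda>L. (rt * num_sites L)\<^sup>2)"
    using num_sites_bounds rt_nonneg
    by (intro integrable_pmf_bounded[where B = "(rt * real (card K))\<^sup>2"]) (simp add: power_mono mult_left_mono)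
  have exX: "E (\<lambda>L. (num_ess L / real N - c)\<^sup>2) = E (\<lambda>L. (num_ess L)\<^sup>2) / (real N)\<^sup>2 - 2 * c * E num_ess / real N + c\<^sup>2"
  proof -
    have "(\<lambda>L. (num_ess L / real N - c)\<^sup>2) = (\<lambda>L. (num_ess L)\<^sup>2 / (real N)\<^sup>2 - (2 * c / real N) * num_ess L + c\<^sup>2)"
      by (simp add: power2_diff power_divide fun_eq_iff)
    then show ?thesis
      using intX intX2 by (simp only:) simp
  qed
  have exM: "E (\<lambda>L. (rt * num_sites L / real N - c)\<^sup>2) =
      E (\<lambda>L. (rt * num_sites L)\<^sup>2) / (real N)\<^sup>2 - 2 * c * E num_ess / real N + c\<^sup>2"
  proof -
    have "(\<lambda>L. (rt * num_sites L / real N - c)\<^sup>2) =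
        (\<lambda>L. (rt * num_sites L)\<^sup>2 / (real N)\<^sup>2 - (2 * c / real N) * (rt * num_sites L) + c\<^sup>2)"
      by (simp add: power2_diff power_divide fun_eq_iff)
    then show ?thesis
      using intM intM2 by (simp only: expectation_num_ess) simp
  qed
  have "E (\<lambda>L. (num_ess L)\<^sup>2) / (real N)\<^sup>2 \<le>
      (real N * beta k + E (\<lambda>L. (rt * num_sites L)\<^sup>2) + real k * beta k * (beta k + 1) * (real N * sqrt (real N))) / (real N)\<^sup>2"
    using expectation_num_ess_square expectation_num_ess_le by (intro divide_right_mono) auto
  also have "\<dots> = E (\<lambda>L. (rt * num_sites L)\<^sup>2) / (real N)\<^sup>2 + beta k / real N +
      real k * beta k * (beta k + 1) * ((real N * sqrt (real N)) / (real N)\<^sup>2)"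
    using N by (simp add: add_divide_distrib power2_eq_square)
  also have "(real N * sqrt (real N)) / (real N)\<^sup>2 = 1 / sqrt (real N)"
    using N real_sqrt_mult_self[of "real N"] by (simp add: power2_eq_square field_simps)
  finally show ?thesis
    unfolding exX exM by simp
qed

end

section \<open>Convergence in probability\<close>

text \<open>Bounded convergence: the square is at most \<open>t^2\<close> off the deviation event
  and at most \<open>B^2\<close> on it.\<close>

lemma expectation_square_tendsto_0:
  fixes Y :: "nat \<Rightarrow> 'a \<Rightarrow> real"
  assumes conv: "conv_in_prob P Y c" and bound: "\<forall>\<^sub>F N in sequentially. \<forall>x. \<bar>Y N x - c\<bar> \<le> B"
  shows "(\<lambda>N. measure_pmf.expectation (P N) (\<lambda>x. (Y N x - c)\<^sup>2)) \<longlonglongrightarrow> 0"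
proof (rule tendstoI)
  fix e :: real assume e: "e > 0"
  define t where "t = sqrt (e / 2)"
  have t: "t > 0" "t\<^sup>2 = e / 2"
    using e by (auto simp: t_def)
  \<comment> \<open>The summand 1 keeps the denominator positive when \<open>B = 0\<close>.\<close>
  define b where "b = (e / 2) / (B\<^sup>2 + 1)"
  have B1: "B\<^sup>2 + 1 > 0"
    by (simp add: add_nonneg_pos)
  have cancel: "u * (y / u) = y" if "u > 0" for u y :: real
    using that by simp
  have b: "b > 0"
    using e B1 by (simp add: b_def)
  have "(\<lambda>N. measure_pmf.prob (P N) {x. \<bar>Y N x - c\<bar> > t}) \<longlonglongrightarrow> 0"
    using conv t by (simp add: conv_in_prob_def)
  from order_tendstoD(2)[OF this b] bound
  show "\<forall>\<^sub>F N in sequentially. dist (measure_pmf.expectation (P N) (\<lambda>x. (Y N x - c)\<^sup>2)) 0 < e"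
  proof eventually_elim
    case (elim N)
    have sq: "(Y N x - c)\<^sup>2 \<le> B\<^sup>2" for x
      using power_mono[of "\<bar>Y N x - c\<bar>" B 2] elim(2) by simp
    have "measure_pmf.expectation (P N) (\<lambda>x. (Y N x - c)\<^sup>2) \<le>
        measure_pmf.expectation (P N) (\<lambda>x. t\<^sup>2 + B\<^sup>2 * of_bool (\<bar>Y N x - c\<bar> > t))"
    proof (rule integral_mono)
      show "integrable (measure_pmf (P N)) (\<lambda>x. (Y N x - c)\<^sup>2)"
        by (rule integrable_pmf_bounded[where B = "B\<^sup>2"]) (simp add: sq)
      show "(Y N x - c)\<^sup>2 \<le> t\<^sup>2 + B\<^sup>2 * of_bool (\<bar>Y N x - c\<bar> > t)" for x
      proof (cases "\<bar>Y N x - c\<bar> > t")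
        case True
        then show ?thesis
          using sq[of x] by (simp add: add_increasing)
      next
        case False
        then show ?thesis
          using power_mono[of "\<bar>Y N x - c\<bar>" t 2] by simp
      qed
    qed (simp add: integrable_of_bool)
    also have "\<dots> = e / 2 + B\<^sup>2 * measure_pmf.prob (P N) {x. \<bar>Y N x - c\<bar> > t}"
      by (simp add: integrable_of_bool expectation_of_bool t)
    also have "\<dots> \<le> e / 2 + B\<^sup>2 * b"
      using elim(1) by (intro add_left_mono mult_left_mono) auto
    also have "\<dots> < e / 2 + (B\<^sup>2 + 1) * b"
      using b by (intro add_strict_left_mono mult_strict_right_mono) auto
    also have "(B\<^sup>2 + 1) * b = e / 2"
      unfolding b_def by (rule cancel[OF B1])
    finally show ?case
      by (simp add: dist_real_def)
  qed
qed

text \<open>The variance of \<open>\<bar>f x\<bar>\<close> is nonnegative.\<close>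

lemma abs_expectation_le_sqrt:
  fixes f :: "'a \<Rightarrow> real"
  assumes "\<And>x. \<bar>f x\<bar> \<le> B"
  shows "measure_pmf.expectation p (\<lambda>x. \<bar>f x\<bar>) \<le> sqrt (measure_pmf.expectation p (\<lambda>x. (f x)\<^sup>2))"
proof -
  let ?m = "measure_pmf.expectation p (\<lambda>x. \<bar>f x\<bar>)"
  have int: "integrable p (\<lambda>x. \<bar>f x\<bar>)"
    by (rule integrable_pmf_bounded[where B = B]) (simp add: assms)
  have int2: "integrable p (\<lambda>x. (f x)\<^sup>2)"
    using power_mono[OF assms, of _ 2] by (intro integrable_pmf_bounded[where B = "B\<^sup>2"]) simp
  have "0 \<le> measure_pmf.expectation p (\<lambda>x. (\<bar>f x\<bar> - ?m)\<^sup>2)"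
    by simp
  also have "(\<lambda>x. (\<bar>f x\<bar> - ?m)\<^sup>2) = (\<lambda>x. (f x)\<^sup>2 - 2 * ?m * \<bar>f x\<bar> + ?m\<^sup>2)"
    by (simp add: power2_diff fun_eq_iff)
  also have "measure_pmf.expectation p \<dots> = measure_pmf.expectation p (\<lambda>x. (f x)\<^sup>2) - 2 * ?m * ?m + ?m\<^sup>2"
    using int int2 by simp
  finally have "?m\<^sup>2 \<le> measure_pmf.expectation p (\<lambda>x. (f x)\<^sup>2)"
    by (simp add: power2_eq_square)
  then show ?thesis
    by (rule real_le_rsqrt)
qed

text \<open>Markov's inequality. The bound \<open>B N\<close> provides integrability and may grow
  with \<open>N\<close>.\<close>

lemma conv_in_prob_if_L1:
  fixes Y :: "nat \<Rightarrow> 'a \<Rightarrow> real"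
  assumes lim: "(\<lambda>N. measure_pmf.expectation (P N) (\<lambda>x. \<bar>Y N x - c\<bar>)) \<longlonglongrightarrow> 0"
    and bound: "\<And>N x. \<bar>Y N x - c\<bar> \<le> B N"
  shows "conv_in_prob P Y c"
  unfolding conv_in_prob_def
proof (intro allI impI)
  fix e :: real assume e: "e > 0"
  have lim': "(\<lambda>N. measure_pmf.expectation (P N) (\<lambda>x. \<bar>Y N x - c\<bar>) / e) \<longlonglongrightarrow> 0"
    using tendsto_divide[OF lim tendsto_const, of e] e by simp
  show "(\<lambda>N. measure_pmf.prob (P N) {x. \<bar>Y N x - c\<bar> > e}) \<longlonglongrightarrow> 0"
  proof (rule tendsto_sandwich[OF _ _ tendsto_const lim'])
    show "\<forall>\<^sub>F N in sequentially. measure_pmf.prob (P N) {x. \<bar>Y N x - c\<bar> > e} \<le>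
        measure_pmf.expectation (P N) (\<lambda>x. \<bar>Y N x - c\<bar>) / e"
    proof (intro always_eventually allI)
      fix N
      have "measure_pmf.prob (P N) {x. \<bar>Y N x - c\<bar> > e} \<le> measure_pmf.prob (P N) {x. \<bar>Y N x - c\<bar> \<ge> e}"
        by (intro measure_pmf.finite_measure_mono) auto
      also have "\<dots> \<le> measure_pmf.expectation (P N) (\<lambda>x. \<bar>Y N x - c\<bar>) / e"
        by (rule prob_ge_le_expectation[where B = "B N"]) (use bound e in auto)
      finally show "measure_pmf.prob (P N) {x. \<bar>Y N x - c\<bar> > e} \<le>
          measure_pmf.expectation (P N) (\<lambda>x. \<bar>Y N x - c\<bar>) / e" .
    qed
  qed simp
qed

text \<open>A continuous mapping principle in which \<open>f\<close> may depend on \<open>N\<close>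
  as well. Stating \<open>lim\<close> for arbitrary filters lets it be proved by the usual limit
  rules.\<close>

lemma conv_in_prob_compose:
  fixes f :: "nat \<times> nat \<Rightarrow> real" and S :: "nat \<Rightarrow> 'a \<Rightarrow> nat"
  assumes conv: "conv_in_prob P (\<lambda>N x. real (S N x) / real N) t"
    and lim: "\<And>F. filterlim fst at_top F \<Longrightarrow> ((\<lambda>(N, s). real s / real N) \<longlongrightarrow> t) F \<Longrightarrow> (f \<longlongrightarrow> c) F"
  shows "conv_in_prob P (\<lambda>N x. f (N, S N x)) c"
  unfolding conv_in_prob_def
proof (intro allI impI)
  fix e :: real assume e: "e > 0"
  \<comment> \<open>The coarsest filter along which \<open>N\<close> tends to infinity and
    \<open>s / N\<close> to \<open>t\<close>. Convergence along it means closeness for all large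
    \<open>N\<close> and all \<open>s / N\<close> near \<open>t\<close>, uniformly.\<close>
  define F :: "(nat \<times> nat) filter" where
    "F = inf (filtercomap fst at_top) (filtercomap (\<lambda>(N, s). real s / real N) (nhds t))"
  have "filterlim fst at_top F"
    by (rule filterlim_mono[OF filterlim_filtercomap order_refl]) (simp add: F_def)
  moreover have "((\<lambda>(N, s). real s / real N) \<longlongrightarrow> t) F"
    by (rule filterlim_mono[OF filterlim_filtercomap order_refl]) (simp add: F_def)
  ultimately have "(f \<longlongrightarrow> c) F"
    by (rule lim)
  from tendstoD[OF this e] have "\<forall>\<^sub>F p in F. dist (f p) c < e" .
  then obtain Q1 Q2 where Q: "eventually Q1 (filtercomap fst at_top)"
      "eventually Q2 (filtercomap (\<lambda>(N, s). real s / real N) (nhds t))"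
      "\<And>p. Q1 p \<Longrightarrow> Q2 p \<Longrightarrow> dist (f p) c < e"
    unfolding F_def eventually_inf by blast
  obtain R1 where R1: "eventually R1 at_top" "\<And>p. R1 (fst p) \<Longrightarrow> Q1 p"
    using Q(1) unfolding eventually_filtercomap by blast
  obtain R2 where R2: "eventually R2 (nhds t)" "\<And>p. R2 (case p of (N, s) \<Rightarrow> real s / real N) \<Longrightarrow> Q2 p"
    using Q(2) unfolding eventually_filtercomap by blast
  obtain r where r: "r > 0" "\<And>y. dist y t < r \<Longrightarrow> R2 y"
    using R2(1) unfolding eventually_nhds_metric by blast
  have close: "dist (f (N, s)) c < e" if "R1 N" "dist (real s / real N) t < r" for N s
    using Q(3)[of "(N, s)"] R1(2)[of "(N, s)"] R2(2)[of "(N, s)"] r(2)[OF that(2)] that(1) by simp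
  \<comment> \<open>Leaving the open ball of radius \<open>r\<close> only gives distance at least
    \<open>r\<close>; halving the radius yields the strict inequality in
    \<open>conv_in_prob\<close>.\<close>
  have lim_S: "(\<lambda>N. measure_pmf.prob (P N) {x. \<bar>real (S N x) / real N - t\<bar> > r / 2}) \<longlonglongrightarrow> 0"
    by (rule conv[unfolded conv_in_prob_def, rule_format, OF half_gt_zero[OF r(1)]])
  show "(\<lambda>N. measure_pmf.prob (P N) {x. \<bar>f (N, S N x) - c\<bar> > e}) \<longlonglongrightarrow> 0"
  proof (rule tendsto_sandwich[OF _ _ tendsto_const lim_S])
    show "\<forall>\<^sub>F N in sequentially. measure_pmf.prob (P N) {x. \<bar>f (N, S N x) - c\<bar> > e} \<le>
        measure_pmf.prob (P N) {x. \<bar>real (S N x) / real N - t\<bar> > r / 2}"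
      using R1(1)
    proof eventually_elim
      case (elim N)
      show ?case
      proof (intro measure_pmf.finite_measure_mono Collect_mono impI)
        fix x assume "\<bar>f (N, S N x) - c\<bar> > e"
        then have "\<not> dist (real (S N x) / real N) t < r"
          using close[OF elim, of "S N x"] by (auto simp: dist_real_def)
        then show "\<bar>real (S N x) / real N - t\<bar> > r / 2"
          using r(1) by (simp add: dist_real_def)
      qed simp
    qed
  qed simp
qed

section \<open>Limits for the essential edges\<close>

context hypergraph_limit
begin

definition ess_limit :: "nat \<Rightarrow> real" where
  "ess_limit k = real k * (1 - ts) * ts ^ (k - 1) * beta k"

lemma ess_limit_bounds:
  assumes "k \<ge> 1"
  shows "0 \<le> ess_limit k" "ess_limit k \<le> real k * beta k"
proof -
  have "0 \<le> ts ^ (k - 1)" "ts ^ (k - 1) \<le> 1"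
    using ts_range by (auto intro: power_le_one)
  then have "0 \<le> (1 - ts) * ts ^ (k - 1)" "(1 - ts) * ts ^ (k - 1) \<le> 1"
    using ts_range by (auto intro: mult_le_one)
  moreover have "real k * beta k \<ge> 0"
    using nonneg[OF assms] by simp
  ultimately have "0 \<le> (real k * beta k) * ((1 - ts) * ts ^ (k - 1))"
    "(real k * beta k) * ((1 - ts) * ts ^ (k - 1)) \<le> (real k * beta k) * 1"
    by (blast intro: mult_nonneg_nonneg mult_left_mono)+
  then show "0 \<le> ess_limit k" "ess_limit k \<le> real k * beta k"
    by (simp_all add: ess_limit_def mult_ac)
qed

text \<open>For \<open>1 \<le> k \<le> N\<close> this has the same mean as the density of essential
  \<open>k\<close>-edges, but it depends on the hypergraph only through the size of the
  closure.\<close>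

definition comp_density :: "nat \<Rightarrow> nat \<Rightarrow> (nat set \<Rightarrow> nat) \<Rightarrow> real" where
  "comp_density k N L = edge_rate beta N k * edge_moments.num_sites N k L / real N"

lemma comp_density_conv:
  assumes k: "k \<ge> 1"
  shows "conv_in_prob (poisson_hypergraph beta) (comp_density k) (ess_limit k)"
proof -
  \<comment> \<open>The closed form in \<open>N\<close> and the closure size. It agrees with
    \<open>comp_density\<close> once \<open>N \<ge> k\<close>, which suffices for the limit.\<close>
  define f where "f = (\<lambda>(N, s). real k * beta k * (1 - real s / real N) *
    (real (s choose (k - 1)) / real (N - 1 choose (k - 1))))"
  have conv: "conv_in_prob (poisson_hypergraph beta) (\<lambda>N L. f (N, card (patch_closure N L))) (ess_limit k)"
  proof (rule conv_in_prob_compose[OF card_patch_closure_concentrated])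
    fix F :: "(nat \<times> nat) filter"
    assume F: "filterlim fst at_top F" "((\<lambda>(N, s). real s / real N) \<longlongrightarrow> ts) F"
    have s: "((\<lambda>p. real (snd p) / real (fst p)) \<longlongrightarrow> ts) F"
      using F(2) by (simp add: case_prod_unfold)
    have "((\<lambda>p. real k * beta k * (1 - real (snd p) / real (fst p)) *
        (real (snd p choose (k - 1)) / real (fst p - 1 choose (k - 1)))) \<longlongrightarrow>
        real k * beta k * (1 - ts) * ts ^ (k - 1)) F"
      by (intro tendsto_mult tendsto_diff tendsto_const s binomial_ratio_tendsto[OF F(1) s])
    then show "(f \<longlongrightarrow> ess_limit k) F"
      by (simp add: f_def case_prod_unfold ess_limit_def mult_ac)
  qed
  have eq: "comp_density k N L = f (N, card (patch_closure N L))" if "N \<ge> k" for N L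
  proof -
    interpret edge_moments beta N k
      using k that by unfold_locales auto
    have N: "N \<ge> 1"
      using k that by simp
    have le: "card (patch_closure N L) \<le> N"
      using card_mono[OF finite_lessThan patch_closure_subset[of N L]] by simp
    have rate: "edge_rate beta N k = real k * beta k / real (N - 1 choose (k - 1))"
      using edge_rate_Suc[OF N, of "k - 1"] k by simp
    have "1 - real (card (patch_closure N L)) / real N = real (N - card (patch_closure N L)) / real N"
      using N le by (simp add: of_nat_diff field_simps)
    then show ?thesis
      unfolding comp_density_def num_sites_eq rate f_def by (simp add: mult_ac)
  qed
  show ?thesis
    unfolding conv_in_prob_def
  proof (intro allI impI)
    fix e :: real assume "e > 0"
    then have "(\<lambda>N. measure_pmf.prob (poisson_hypergraph beta N)
        {L. \<bar>f (N, card (patch_closure N L)) - ess_limit k\<bar> > e}) \<longlonglongrightarrow> 0"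
      using conv by (simp add: conv_in_prob_def)
    then show "(\<lambda>N. measure_pmf.prob (poisson_hypergraph beta N)
        {L. \<bar>comp_density k N L - ess_limit k\<bar> > e}) \<longlonglongrightarrow> 0"
      by (rule Lim_transform_eventually)
         (use eq in \<open>auto intro!: eventually_mono[OF eventually_ge_at_top[of k]]\<close>)
  qed
qed

lemma comp_density_bound:
  assumes "k \<ge> 1" "N \<ge> k"
  shows "\<bar>comp_density k N L - ess_limit k\<bar> \<le> real k * beta k"
proof -
  interpret edge_moments beta N k
    using assms by unfold_locales auto
  have "rt * num_sites L \<le> rt * real (card K)"
    using num_sites_bounds rt_nonneg by (intro mult_left_mono) auto
  then have "rt * num_sites L \<le> real N * beta k"
    using card_K_rt by (simp add: mult.commute)
  then have "comp_density k N L \<le> beta k"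
    using assms by (simp add: comp_density_def field_simps)
  also have "\<dots> \<le> real k * beta k"
    using nonneg[OF assms(1)] assms(1) mult_right_mono[of 1 "real k" "beta k"] by simp
  finally have "comp_density k N L \<le> real k * beta k" .
  moreover have "comp_density k N L \<ge> 0"
    using num_sites_bounds rt_nonneg by (simp add: comp_density_def)
  ultimately show ?thesis
    using ess_limit_bounds[OF assms(1)] by linarith
qed

text \<open>An L1 distance rather than a probability, so that the errors can be summed over
  \<open>k\<close>.\<close>

definition ess_error :: "nat \<Rightarrow> nat \<Rightarrow> real" where
  "ess_error k N = measure_pmf.expectation (poisson_hypergraph beta N)
    (\<lambda>L. \<bar>real (essential_count N k L) / real N - ess_limit k\<bar>)"

lemma essential_count_le: "real (essential_count N k L) \<le> real (N choose k)"
proof -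
  have "real (essential_count N k L) \<le> (\<Sum>A\<in>k_sets N k. 1)"
    unfolding essential_count_eq by (intro sum_mono) auto
  then show ?thesis
    by (simp add: card_k_sets)
qed

lemma essential_density_bound:
  "\<bar>real (essential_count N k L) / real N - c\<bar> \<le> real (N choose k) + \<bar>c\<bar>"
proof -
  have "real (essential_count N k L) / real N \<le> real (essential_count N k L)"
    by (cases "N = 0") (auto simp: divide_le_eq mult_le_cancel_left1)
  then have "real (essential_count N k L) / real N \<le> real (N choose k)"
    using essential_count_le[of N k L] by linarith
  moreover have "real (essential_count N k L) / real N \<ge> 0"
    by simp
  ultimately show ?thesis
    by linarith
qed

lemma ess_error_tendsto_0:
  assumes k: "k \<ge> 1"
  shows "ess_error k \<longlonglongrightarrow> 0"
proof -
  define g where "g N = measure_pmf.expectation (poisson_hypergraph beta N) (\<lambda>L. (comp_density k N L - ess_limit k)\<^sup>2) +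
    beta k / real N + real k * beta k * (beta k + 1) / sqrt (real N)" for N
  have sq: "(\<lambda>N. measure_pmf.expectation (poisson_hypergraph beta N) (\<lambda>L. (comp_density k N L - ess_limit k)\<^sup>2)) \<longlonglongrightarrow> 0"
    by (rule expectation_square_tendsto_0[OF comp_density_conv[OF k], where B = "real k * beta k"])
       (use comp_density_bound[OF k] in \<open>auto intro!: eventually_mono[OF eventually_ge_at_top[of k]]\<close>)
  have n1: "(\<lambda>N. beta k / real N) \<longlonglongrightarrow> 0"
    by (rule lim_const_over_n)
  have n2: "(\<lambda>N. real k * beta k * (beta k + 1) / sqrt (real N)) \<longlonglongrightarrow> 0"
    by (intro tendsto_divide_0[OF tendsto_const] filterlim_at_top_imp_at_infinity
        filterlim_compose[OF sqrt_at_top filterlim_real_sequentially])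
  have "g \<longlonglongrightarrow> 0 + 0 + 0"
    unfolding g_def by (intro tendsto_add sq n1 n2)
  then have "(\<lambda>N. sqrt (g N)) \<longlonglongrightarrow> sqrt 0"
    by (intro tendsto_real_sqrt) simp
  then have lim: "(\<lambda>N. sqrt (g N)) \<longlonglongrightarrow> 0"
    by simp
  show ?thesis
  proof (rule tendsto_sandwich[OF _ _ tendsto_const lim])
    show "\<forall>\<^sub>F N in sequentially. 0 \<le> ess_error k N"
      by (simp add: ess_error_def)
    show "\<forall>\<^sub>F N in sequentially. ess_error k N \<le> sqrt (g N)"
      using eventually_ge_at_top[of k]
    proof eventually_elim
      case (elim N)
      interpret edge_moments beta N k
        using k elim by unfold_locales auto
      have "ess_error k N \<le> sqrt (E (\<lambda>L. (real (essential_count N k L) / real N - ess_limit k)\<^sup>2))"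
        unfolding ess_error_def by (rule abs_expectation_le_sqrt[OF essential_density_bound])
      also have "\<dots> \<le> sqrt (g N)"
        using expectation_num_ess_deviation[of "ess_limit k"]
        by (simp add: g_def num_ess_def essential_count_eq comp_density_def)
      finally show ?case .
    qed
  qed
qed

text \<open>The bound is uniform in \<open>N\<close> and summable in \<open>k\<close>, so it can
  dominate the series of errors.\<close>

lemma ess_error_bound:
  assumes "k \<ge> 1" "N \<ge> k"
  shows "ess_error k N \<le> 2 * (real k * beta k)"
proof -
  interpret edge_moments beta N k
    using assms by unfold_locales auto
  have N: "real N > 0"
    using assms by simp
  have intX: "integrable P num_ess"
    using num_ess_bounds by (auto intro!: integrable_pmf_bounded[where B = "real (card K)"])
  have "ess_error k N \<le> E (\<lambda>L. num_ess L / real N + ess_limit k)"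
    unfolding ess_error_def essential_count_eq num_ess_def[symmetric]
  proof (rule integral_mono)
    show "integrable P (\<lambda>L. \<bar>num_ess L / real N - ess_limit k\<bar>)"
      using intX by simp
    show "\<bar>num_ess L / real N - ess_limit k\<bar> \<le> num_ess L / real N + ess_limit k" for L
    proof -
      have "num_ess L / real N \<ge> 0"
        using num_ess_bounds by simp
      then show ?thesis
        using ess_limit_bounds[OF assms(1)] by linarith
    qed
  qed (use intX in simp)
  also have "\<dots> = E num_ess / real N + ess_limit k"
    using intX by simp
  also have "\<dots> \<le> beta k + real k * beta k"
    using expectation_num_ess_le N ess_limit_bounds[OF assms(1)] by (intro add_mono) (simp_all add: field_simps)
  also have "\<dots> \<le> 2 * (real k * beta k)"
    using nonneg[OF assms(1)] assms(1) mult_right_mono[of 1 "real k" "beta k"] by simp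
  finally show ?thesis .
qed

lemma essential_count_conv:
  assumes "k \<ge> 1"
  shows "conv_in_prob (poisson_hypergraph beta) (\<lambda>N L. real (essential_count N k L) / real N) (ess_limit k)"
proof (rule conv_in_prob_if_L1[OF _ essential_density_bound])
  show "(\<lambda>N. measure_pmf.expectation (poisson_hypergraph beta N)
      (\<lambda>L. \<bar>real (essential_count N k L) / real N - ess_limit k\<bar>)) \<longlonglongrightarrow> 0"
    using ess_error_tendsto_0[OF assms] unfolding ess_error_def[abs_def] .
qed

lemma ess_limit_sums: "(\<lambda>j. ess_limit (Suc j)) sums (- (1 - ts) * ln (1 - ts))"
proof -
  have "(\<lambda>j. real (Suc j) * beta (Suc j) * ts ^ j) sums dbeta ts"
    unfolding dbeta_def using ts_range by (intro summable_sums summable_dbeta) auto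
  from sums_mult[OF this, of "1 - ts"]
  have "(\<lambda>j. ess_limit (Suc j)) sums ((1 - ts) * dbeta ts)"
    by (simp add: ess_limit_def mult_ac)
  then show ?thesis
    unfolding dbeta_ts by (simp only: mult_minus_left mult_minus_right)
qed

text \<open>The total is compared with the partial sums of the limits in L1. Tannery's theorem
  exchanges the limit with the sum of the errors over all sizes, and \<open>rest\<close> is the tail
  of the limiting series.\<close>

lemma essential_total_conv:
  "conv_in_prob (poisson_hypergraph beta) (\<lambda>N L. real (essential_total N L) / real N)
    (- (1 - ts) * ln (1 - ts))"
proof -
  define C where "C = - (1 - ts) * ln (1 - ts)"
  \<comment> \<open>Extension by 0 beyond size \<open>N\<close> turns the finite sums into full
    series with a common dominating sequence.\<close>
  define a where "a j N = (if Suc j \<le> N then ess_error (Suc j) N else 0)" for j N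
  define rest where "rest N = \<bar>(\<Sum>j<N. ess_limit (Suc j)) - C\<bar>" for N
  have rest: "rest \<longlonglongrightarrow> 0"
  proof -
    have "(\<lambda>N. (\<Sum>j<N. ess_limit (Suc j)) - C) \<longlonglongrightarrow> C - C"
      using ess_limit_sums unfolding sums_def C_def by (intro tendsto_diff tendsto_const)
    then show ?thesis
      unfolding rest_def by (simp add: tendsto_rabs_zero)
  qed
  have "(\<lambda>N. \<Sum>j. a j N) \<longlonglongrightarrow> (\<Sum>j. 0)"
  proof (intro tannerys_theorem[THEN conjunct2, THEN conjunct2])
    show "a j \<longlonglongrightarrow> 0" for j
      by (rule Lim_transform_eventually[OF ess_error_tendsto_0[of "Suc j"]])
         (auto simp: a_def intro!: eventually_mono[OF eventually_ge_at_top[of "Suc j"]])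
    have "norm (a j N) \<le> 2 * (real (Suc j) * beta (Suc j))" for j N
    proof (cases "Suc j \<le> N")
      case True
      have "ess_error (Suc j) N \<ge> 0"
        by (simp add: ess_error_def)
      then show ?thesis
        using ess_error_bound[of "Suc j" N] True by (simp add: a_def)
    next
      case False
      then show ?thesis
        using nonneg[of "Suc j"] by (simp add: a_def)
    qed
    then show "\<forall>\<^sub>F (j, N) in at_top \<times>\<^sub>F sequentially. norm (a j N) \<le> 2 * (real (Suc j) * beta (Suc j))"
      by (auto intro!: always_eventually)
    show "summable (\<lambda>j. 2 * (real (Suc j) * beta (Suc j)))"
      by (rule summable_mult[OF summ])
  qed simp
  moreover have "(\<Sum>j. a j N) = (\<Sum>j<N. ess_error (Suc j) N)" for N
    by (subst suminf_finite[of "{..<N}"]) (auto simp: a_def)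
  ultimately have errs: "(\<lambda>N. \<Sum>j<N. ess_error (Suc j) N) \<longlonglongrightarrow> 0"
    by simp
  have tot: "real (essential_total N L) / real N = (\<Sum>j<N. real (essential_count N (Suc j) L) / real N)" for N L
    unfolding essential_total_def of_nat_sum sum_divide_distrib
    by (rule sum.reindex_bij_witness[of _ Suc "\<lambda>k. k - 1"]) auto
  have pointwise: "\<bar>real (essential_total N L) / real N - C\<bar> \<le>
      (\<Sum>j<N. \<bar>real (essential_count N (Suc j) L) / real N - ess_limit (Suc j)\<bar>) + rest N" for N L
  proof -
    have "real (essential_total N L) / real N - C =
        (\<Sum>j<N. real (essential_count N (Suc j) L) / real N - ess_limit (Suc j)) + ((\<Sum>j<N. ess_limit (Suc j)) - C)"
      unfolding tot by (simp add: sum_subtractf)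
    also have "\<bar>\<dots>\<bar> \<le> \<bar>\<Sum>j<N. real (essential_count N (Suc j) L) / real N - ess_limit (Suc j)\<bar> + rest N"
      unfolding rest_def by (rule abs_triangle_ineq)
    also have "\<dots> \<le> (\<Sum>j<N. \<bar>real (essential_count N (Suc j) L) / real N - ess_limit (Suc j)\<bar>) + rest N"
      by (intro add_right_mono sum_abs)
    finally show ?thesis .
  qed
  define B where "B N = (\<Sum>j<N. real (N choose Suc j) + \<bar>ess_limit (Suc j)\<bar>) + rest N" for N
  have bound: "\<bar>real (essential_total N L) / real N - C\<bar> \<le> B N" for N L
    unfolding B_def
    by (rule order_trans[OF pointwise]) (intro add_right_mono sum_mono essential_density_bound)
  have int: "integrable (measure_pmf p) (\<lambda>L. \<bar>real (essential_count N k L) / real N - c\<bar>)" for p N k c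
    by (rule integrable_pmf_bounded[where B = "real (N choose k) + \<bar>c\<bar>"])
       (use essential_density_bound in simp)
  have "(\<lambda>N. measure_pmf.expectation (poisson_hypergraph beta N)
      (\<lambda>L. \<bar>real (essential_total N L) / real N - C\<bar>)) \<longlonglongrightarrow> 0"
  proof (rule tendsto_sandwich[OF _ _ tendsto_const tendsto_add_zero[OF errs rest]])
    show "\<forall>\<^sub>F N in sequentially. measure_pmf.expectation (poisson_hypergraph beta N)
        (\<lambda>L. \<bar>real (essential_total N L) / real N - C\<bar>) \<le> (\<Sum>j<N. ess_error (Suc j) N) + rest N"
    proof (intro always_eventually allI)
      fix N
      have "measure_pmf.expectation (poisson_hypergraph beta N)
          (\<lambda>L. \<bar>real (essential_total N L) / real N - C\<bar>) \<le>
        measure_pmf.expectation (poisson_hypergraph beta N)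
          (\<lambda>L. (\<Sum>j<N. \<bar>real (essential_count N (Suc j) L) / real N - ess_limit (Suc j)\<bar>) + rest N)"
        by (rule integral_mono[OF integrable_pmf_bounded[where B = "B N"]])
           (use bound pointwise int in auto)
      also have "\<dots> = (\<Sum>j<N. ess_error (Suc j) N) + rest N"
        unfolding ess_error_def using int by (simp add: Bochner_Integration.integral_sum)
      finally show "measure_pmf.expectation (poisson_hypergraph beta N)
          (\<lambda>L. \<bar>real (essential_total N L) / real N - C\<bar>) \<le> (\<Sum>j<N. ess_error (Suc j) N) + rest N" .
    qed
  qed simp
  from conv_in_prob_if_L1[OF this bound] show ?thesis
    by (simp add: C_def)
qed

end

theorem theorem3:
  fixes beta :: "nat \<Rightarrow> real"
  assumes nonneg: "\<And>k. k \<ge> 1 \<Longrightarrow> beta k \<ge> 0"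
    and summ: "summable (\<lambda>k. real (Suc k) * beta (Suc k))"
    and nozero: "\<And>t. 0 \<le> t \<Longrightarrow> t < tstar beta \<Longrightarrow>
                   deriv (beta_fun beta) t + ln (1 - t) \<noteq> 0"
  shows "(\<forall>k\<ge>1. conv_in_prob (poisson_hypergraph beta)
            (\<lambda>N Lam. real (essential_count N k Lam) / real N)
            (real k * (1 - tstar beta) * tstar beta ^ (k - 1) * beta k)) \<and>
         conv_in_prob (poisson_hypergraph beta)
            (\<lambda>N Lam. real (essential_total N Lam) / real N)
            (- (1 - tstar beta) * ln (1 - tstar beta))"
proof -
  interpret hypergraph_limit beta
    using assms by unfold_locales
  show ?thesis
    using essential_count_conv essential_total_conv unfolding ess_limit_def ts_def by blast
qed

end
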